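(* If $\ker(\zeta^T)\subseteq R_T$ in $\mathbb Q[\mathrm{PT}^{\mathrm{conv}}_{\mathbb N^*}]$, then $\ker(\zeta)\subseteq R_W$ in $\mathbb Q[\mathrm{W}^{\mathrm{conv}}_{\mathbb N^*}]$.
   Context: All vector spaces are over $\mathbb Q$; $\mathbb N^*=\{1,2,3,\dots\}$. Words. $\mathcal W_A$ is the vector space with basis the words over $A$, including the empty word $\emptyset$. On $\mathcal W_{\{x,y\}}$, the shuffle product is the bilinear product with unit $\emptyset$ and $au\mathbin{\mathrm{sh}}bv=a(u\mathbin{\mathrm{sh}}bv)+b(au\mathbin{\mathrm{sh}}v)$ for letters $a,b$ and words $u,v$. On $\mathcal W_{\mathbb N^*}$, the quasi-shuffle product is the bilinear product with unit $\emptyset$ and $au\mathbin{\mathrm{qsh}}bv=a(u\mathbin{\mathrm{qsh}}bv)+b(au\mathbin{\mathrm{qsh}}v)+(a+b)(u\mathbin{\mathrm{qsh}}v)$. The linear injective map $\mathfrak s:\mathcal W_{\mathbb N^*}\to\mathcal W_{\{x,y\}}$ is $\mathfrak s(n_1\cdots n_p)=x^{n_1-1}y\cdots x^{n_p-1}y$, $\mathfrak s(\emptyset)=\emptyset$; its image (spanned by $\emptyset$ and the words ending in $y$) is closed under $\mathrm{sh}$, and $\mathfrak s^{-1}$ is defined on it. $\mathrm W^{\mathrm{conv}}_{\mathbb N^*}$ is the set of non-empty words over $\mathbb N^*$ whose first letter is not $1$ (convergent words), and for such a word $\zeta(n_1\cdots n_p)=\sum_{k_1>\cdots>k_p>0}k_1^{-n_1}\cdots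 k_p^{-n_p}$. Trees. Planar rooted trees are finite rooted trees with linearly ordered children at every vertex. $\mathrm{PT}_\Omega$ is the set of non-empty planar rooted trees with vertices decorated by $\Omega$, $\mathcal{PT}_\Omega$ the vector space with basis $\mathrm{PT}_\Omega$. $B_+^a(T_1\cdots T_k)$ grafts $T_1,\dots,T_k$ in this order on a new root decorated by $a$ (extended multilinearly); $[a]:=B_+^a(\emptyset)$. Forests are finite, possibly empty, sequences of trees. A ladder tree is one in which every vertex has at most one child. For $S=B_+^a(S_1\cdots S_k)$, $T=B_+^b(T_1\cdots T_\ell)$, $k,\ell\ge0$, define inductively and bilinearly $S<T:=B_+^a(S_1\cdots S_{k-1}(S_k\ast T))$ if $k\ge1$, $B_+^a(T)$ if $k=0$; $S>T:=B_+^b((S\ast T_1)T_2\cdots T_\ell)$ if $\ell\ge1$, $B_+^b(S)$ if $\ell=0$; $S\bullet T:=B_+^{a+b}(S_1\cdots S_{k-1}(S_k\ast T_1)T_2\cdots T_\ell)$ if $k,\ell\ge1$, $B_+^{a+b}(T_1\cdots T_\ell)$ if $k=0$, $B_+^{a+b}(S_1\cdots S_k)$ if $\ell=0$. On $\mathcal{PT}_{\{x,y\}}$, $\ast=\mathrm{sh}^T:={<}+{>}$; on $\mathcal{PT}_{\mathbb N^*}$, $\ast=\mathrm{qsh}^T:={<}+{>}+\bullet$. $\mathrm{PT}^{\mathrm{conv}}_{\mathbb N^*}$ is the set of trees in $\mathrm{PT}_{\mathbb N^*}$ whose root is not decorated by $1$ (convergent trees). With $V(t)$ ordered so that the root is minimal,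 $\zeta^T(t)=\sum\prod_{v\in V(t)}k_v^{-n_v}$, the sum over $(k_v)\in(\mathbb N^* )^{V(t)}$ with $k_v<k_u$ whenever $u<v$, where $n_v$ is the decoration of $v$. Binarisation. $\mathfrak s^{PN}:\mathcal{PT}_{\mathbb N^*}\to\mathcal{PT}_{\{x,y\}}$ is linear with $\mathfrak s^{PN}(B_+^n(T_1\cdots T_k))=(B_+^x)^{\circ(n-1)}\circ B_+^y(\mathfrak s^{PN}(T_1)\cdots\mathfrak s^{PN}(T_k))$. A non-ladder tree $T\in\mathrm{PT}_{\mathbb N^*}$ is uniquely $T=B\big(B_+^{n_a}(F_a)B_+^{n_b}(F_b)F\big)$ with $B=B_+^{n_1}\circ\cdots\circ B_+^{n_p}$, $p\ge1$, and $F_a,F_b,F$ possibly empty forests. Set $T^a_b:=B(B_+^{n_a}(B_+^{n_b}(F_b)F_a)F)$, $T^b_a:=B(B_+^{n_b}(B_+^{n_a}(F_a)F_b)F)$, $T_{a+b}:=B(B_+^{n_a+n_b}(F_aF_b)F)$. The process tree $\mathrm{pr}(T)$, with vertices decorated by trees (decoration map $\delta_{\mathrm{pr}(T)}$), is defined by the well-founded recursion: a single vertex decorated by $T$ if $T$ is a ladder tree; otherwise a root decorated by $T$ with children subtrees $\mathrm{pr}(T_{a+b}),\mathrm{pr}(T^a_b),\mathrm{pr}(T^b_a)$. Put $T^e=0$ if $T$ is a ladder tree and otherwise $$T^e=T_{a+b}-\sum_{i=1}^{n_a-1}\binom{n_a-i+n_b-1}{n_b-1}B\big(B_+^{n_a+n_b-i}(B_+^i(F_a)F_b)F\big)-\sum_{i=1}^{n_b-1}\binom{n_b-i+n_a-1}{n_a-1}B\big(B_+^{n_a+n_b-i}(B_+^i(F_b)F_a)F\big).$$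 Let $\phi(T)=T+\sum_{v\in V(\mathrm{pr}(T))}(\delta_{\mathrm{pr}(T)}(v))^e$ (extended linearly) and $\mathfrak s^{PT}:=\mathfrak s^{PN}\circ\phi$. The map $\mathfrak s^{PT}$ is injective, with image the span of trees in $\mathrm{PT}_{\{x,y\}}$ all of whose leaves and branching vertices (at least two children) are decorated by $y$; this image is closed under $\mathrm{sh}^T$, and $(\mathfrak s^{PT})^{-1}$ is defined on it. Polynomial rings and ideals. $\mathbb Q[\mathrm W^{\mathrm{conv}}_{\mathbb N^*}]$ and $\mathbb Q[\mathrm{PT}^{\mathrm{conv}}_{\mathbb N^*}]$ are the commutative polynomial rings whose indeterminates are the convergent words, resp. convergent trees; linear combinations of convergent words (trees) are viewed as polynomials of degree $1$. $\zeta$ and $\zeta^T$ are extended to $\mathbb Q$-algebra morphisms from these rings to $\mathbb R$. $R_W$ is the ideal of $\mathbb Q[\mathrm W^{\mathrm{conv}}_{\mathbb N^*}]$ generated by all $w_1w_2-w_1\mathbin{\mathrm{qsh}}w_2$, $\ w_1w_2-\mathfrak s^{-1}(\mathfrak s(w_1)\mathbin{\mathrm{sh}}\mathfrak s(w_2))$, $\ w\mathbin{\mathrm{qsh}}(1)-\mathfrak s^{-1}(\mathfrak s(w)\mathbin{\mathrm{sh}}(y))$, for convergent words $w,w_1,w_2$ (here $w_1w_2$ is the polynomial product, and $(1)$, $(y)$ are one-letter words). $R_T$ is the ideal of $\mathbb Q[\mathrm{PT}^{\mathrm{conv}}_{\mathbb N^*}]$ generated by all $ST-S\mathbin{\mathrm{qsh}^T}T$,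 $\ ST-(\mathfrak s^{PT})^{-1}(\mathfrak s^{PT}(S)\mathbin{\mathrm{sh}^T}\mathfrak s^{PT}(T))$, $\ U\mathbin{\mathrm{qsh}^T}[1]-(\mathfrak s^{PT})^{-1}(\mathfrak s^{PT}(U)\mathbin{\mathrm{sh}^T}[y])$, $\ S_1-S_2$, for convergent trees $S,T,U,S_1,S_2$ such that $S_1$ and $S_2$ have the same underlying non-planar decorated rooted tree (here $ST$ is the polynomial product). All these expressions are indeed polynomials in convergent words (resp. trees). *)

theory Defs
  imports "HOL-Analysis.Infinite_Sum" "HOL-Library.FuncSet" "HOL-Library.Multiset"
    "HOL-Library.Poly_Mapping" "HOL-Library.Sublist"
begin

section \<open>Free rational vector spaces, polynomial rings, ideals\<close>

text \<open>
  The rational vector space with basis \<open>'a\<close> is \<open>'a \<Rightarrow>\<^sub>0 rat\<close>, and the polynomial ring with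
  indeterminates \<open>'i\<close> is \<open>('i \<Rightarrow>\<^sub>0 nat) \<Rightarrow>\<^sub>0 rat\<close> (monomials are finitely supported exponent
  functions).
\<close>

type_synonym 'a fvec = "'a \<Rightarrow>\<^sub>0 rat"
type_synonym 'i mpoly = "('i \<Rightarrow>\<^sub>0 nat) \<Rightarrow>\<^sub>0 rat"

abbreviation bvec :: "'a \<Rightarrow> 'a fvec" where
  "bvec a \<equiv> Poly_Mapping.single a 1"

definition vscale :: "rat \<Rightarrow> 'a fvec \<Rightarrow> 'a fvec" where
  "vscale c p = Poly_Mapping.map ((*) c) p"

definition lin :: "('a \<Rightarrow> 'b fvec) \<Rightarrow> 'a fvec \<Rightarrow> 'b fvec" where
  "lin f p = (\<Sum>a\<in>Poly_Mapping.keys p. vscale (Poly_Mapping.lookup p a) (f a))"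

abbreviation lin_basis :: "('a \<Rightarrow> 'b) \<Rightarrow> 'a fvec \<Rightarrow> 'b fvec" where
  "lin_basis f \<equiv> lin (\<lambda>a. bvec (f a))"

definition bilin :: "('a \<Rightarrow> 'b \<Rightarrow> 'c fvec) \<Rightarrow> 'a fvec \<Rightarrow> 'b fvec \<Rightarrow> 'c fvec" where
  "bilin f p q = lin (\<lambda>a. lin (f a) q) p"

definition var :: "'i \<Rightarrow> 'i mpoly" where
  "var i = Poly_Mapping.single (Poly_Mapping.single i 1) 1"

text \<open>
  The indeterminates \<open>'i\<close> are a subtype of a basis \<open>'a\<close>, with inclusion \<open>rep\<close>. A linear
  combination of elements of \<open>'a\<close> all lying in the range of \<open>rep\<close> is turned into a polynomial
  of degree 1. This is only used for such combinations; on others, basis elements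
  outside the range of \<open>rep\<close> are ignored.
\<close>

definition linear_poly :: "('i \<Rightarrow> 'a) \<Rightarrow> 'a fvec \<Rightarrow> 'i mpoly" where
  "linear_poly rep p =
     (\<Sum>i | rep i \<in> Poly_Mapping.keys p.
        Poly_Mapping.single 0 (Poly_Mapping.lookup p (rep i)) * var i)"

text \<open>The algebra morphism to the reals sending each \<open>var i\<close> to \<open>f i\<close>.\<close>

definition eval_poly :: "('i \<Rightarrow> real) \<Rightarrow> 'i mpoly \<Rightarrow> real" where
  "eval_poly f P =
     (\<Sum>m\<in>Poly_Mapping.keys P. of_rat (Poly_Mapping.lookup P m) *
        (\<Prod>i\<in>Poly_Mapping.keys m. f i ^ Poly_Mapping.lookup m i))"

definition generated_ideal :: "'r::comm_ring_1 set \<Rightarrow> 'r set" where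
  "generated_ideal S = module.span (*) S"


section \<open>Words\<close>

text \<open>
  Decorations in the positive integers have type \<open>nat\<close>; the decoration 0 is
  excluded by explicit side conditions, and values on words or trees containing 0 are irrelevant.
\<close>

datatype letter = LX | LY

fun sh :: "'a list \<Rightarrow> 'a list \<Rightarrow> 'a list fvec" where
  "sh [] v = bvec v"
| "sh u [] = bvec u"
| "sh (a # u) (b # v) = lin_basis ((#) a) (sh u (b # v)) + lin_basis ((#) b) (sh (a # u) v)"

fun qsh :: "nat list \<Rightarrow> nat list \<Rightarrow> nat list fvec" where
  "qsh [] v = bvec v"
| "qsh u [] = bvec u"
| "qsh (a # u) (b # v) = lin_basis ((#) a) (qsh u (b # v)) + lin_basis ((#) b) (qsh (a # u) v)
     + lin_basis ((#) (a + b)) (qsh u v)"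

definition bin_word :: "nat list \<Rightarrow> letter list" where
  "bin_word w = concat (map (\<lambda>n. replicate (n - 1) LX @ [LY]) w)"

definition bin :: "nat list fvec \<Rightarrow> letter list fvec" where
  "bin = lin_basis bin_word"

definition bin_inv :: "letter list fvec \<Rightarrow> nat list fvec" where
  "bin_inv = inv_into {p. \<forall>w\<in>Poly_Mapping.keys p. 0 \<notin> set w} bin"

typedef conv_word = "{w :: nat list. w \<noteq> [] \<and> 0 \<notin> set w \<and> hd w \<noteq> 1}"
  by (rule exI[of _ "[2]"]) simp

definition zeta :: "nat list \<Rightarrow> real" where
  "zeta w = (\<Sum>\<^sub>\<infinity>k \<in> {k :: nat list. length k = length w \<and> sorted_wrt (>) k \<and> 0 \<notin> set k}.
     \<Prod>i<length w. 1 / real (k ! i) ^ (w ! i))"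

definition zeta_hom :: "conv_word mpoly \<Rightarrow> real" where
  "zeta_hom = eval_poly (\<lambda>w. zeta (Rep_conv_word w))"

definition word_poly :: "nat list fvec \<Rightarrow> conv_word mpoly" where
  "word_poly = linear_poly Rep_conv_word"

definition R_W :: "conv_word mpoly set" where
  "R_W = generated_ideal
    ({var w1 * var w2 - word_poly (qsh (Rep_conv_word w1) (Rep_conv_word w2)) | w1 w2. True} \<union>
     {var w1 * var w2 - word_poly (bin_inv
        (bilin sh (bin (bvec (Rep_conv_word w1))) (bin (bvec (Rep_conv_word w2))))) | w1 w2. True} \<union>
     {word_poly (qsh (Rep_conv_word w) [1] - bin_inv
        (bilin sh (bin (bvec (Rep_conv_word w))) (bvec [LY]))) | w. True})"


section \<open>Planar rooted trees\<close>

datatype 'a ptree = Node (root_deco: 'a) "'a ptree list"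

text \<open>A vertex is addressed by the list of child indices on the path from the root.\<close>

fun subtree_at :: "'a ptree \<Rightarrow> nat list \<Rightarrow> 'a ptree option" where
  "subtree_at T [] = Some T"
| "subtree_at (Node a Ts) (i # p) = (if i < length Ts then subtree_at (Ts ! i) p else None)"

definition vertices :: "'a ptree \<Rightarrow> nat list set" where
  "vertices T = {p. subtree_at T p \<noteq> None}"

definition deco :: "'a ptree \<Rightarrow> nat list \<Rightarrow> 'a" where
  "deco T p = root_deco (the (subtree_at T p))"

lemma finite_vertices: "finite (vertices T)"
proof (induction T)
  case (Node a Ts)
  have "vertices (Node a Ts) \<subseteq> insert [] (\<Union>i\<in>{..<length Ts}. (#) i ` vertices (Ts ! i))"
  proof
    fix p assume "p \<in> vertices (Node a Ts)"
    then show "p \<in> insert [] (\<Union>i\<in>{..<length Ts}. (#) i ` vertices (Ts ! i))"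
      by (cases p) (auto simp: vertices_def split: if_splits)
  qed
  moreover have "finite (insert [] (\<Union>i\<in>{..<length Ts}. (#) i ` vertices (Ts ! i)))"
    using Node by auto
  ultimately show ?case by (rule finite_subset)
qed

fun ladder :: "'a ptree \<Rightarrow> bool" where
  "ladder (Node a Ts) \<longleftrightarrow> length Ts \<le> 1 \<and> (\<forall>T\<in>set Ts. ladder T)"

text \<open>Grafting on a root decorated by \<open>a\<close> the children \<open>L\<close>, a linear combination of trees, \<open>R\<close>.\<close>

definition graft_lin ::
    "'a \<Rightarrow> 'a ptree list \<Rightarrow> 'a ptree fvec \<Rightarrow> 'a ptree list \<Rightarrow> 'a ptree fvec" where
  "graft_lin a L p R = lin_basis (\<lambda>U. Node a (L @ U # R)) p"

lemma size_ptree_child: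
  "T \<in> set Ts \<Longrightarrow> size T < Suc (size_list size Ts)"
  by (simp add: less_Suc_eq_le size_list_estimation')

lemma size_ptree_children:
  "S \<in> set Ss \<Longrightarrow> T \<in> set Ts \<Longrightarrow>
    size S + size T < Suc (Suc (size_list size Ss + size_list size Ts))"
  using size_ptree_child[of S Ss] size_ptree_child[of T Ts] by linarith

text \<open>
  In the two products below the successive summands are \<open>S < T\<close>, \<open>S > T\<close> and, for the second one,
  the bullet product of \<open>S\<close> and \<open>T\<close>.
\<close>

function sh_tree :: "'a ptree \<Rightarrow> 'a ptree \<Rightarrow> 'a ptree fvec" where
  "sh_tree (Node a Ss) (Node b Ts) =
     (if Ss = [] then bvec (Node a [Node b Ts])
      else graft_lin a (butlast Ss) (sh_tree (last Ss) (Node b Ts)) [])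
   + (if Ts = [] then bvec (Node b [Node a Ss])
      else graft_lin b [] (sh_tree (Node a Ss) (hd Ts)) (tl Ts))"
  by pat_completeness auto
termination
  by (relation "measure (\<lambda>(S, T). size S + size T)") (auto intro!: size_ptree_child)

function qsh_tree :: "nat ptree \<Rightarrow> nat ptree \<Rightarrow> nat ptree fvec" where
  "qsh_tree (Node a Ss) (Node b Ts) =
     (if Ss = [] then bvec (Node a [Node b Ts])
      else graft_lin a (butlast Ss) (qsh_tree (last Ss) (Node b Ts)) [])
   + (if Ts = [] then bvec (Node b [Node a Ss])
      else graft_lin b [] (qsh_tree (Node a Ss) (hd Ts)) (tl Ts))
   + (if Ss = [] then bvec (Node (a + b) Ts)
      else if Ts = [] then bvec (Node (a + b) Ss)
      else graft_lin (a + b) (butlast Ss) (qsh_tree (last Ss) (hd Ts)) (tl Ts))"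
  by pat_completeness auto
termination
  by (relation "measure (\<lambda>(S, T). size S + size T)")
    (auto intro!: size_ptree_child size_ptree_children)

datatype 'a nonplanar = NNode 'a "'a nonplanar multiset"

primrec forget_order :: "'a ptree \<Rightarrow> 'a nonplanar" where
  "forget_order (Node a Ts) = NNode a (mset (map forget_order Ts))"


section \<open>Binarisation of trees\<close>

fun bin_naive :: "nat ptree \<Rightarrow> letter ptree" where
  "bin_naive (Node n Ts) = ((\<lambda>T. Node LX [T]) ^^ (n - 1)) (Node LY (map bin_naive Ts))"

text \<open>
  A non-ladder tree is written in the form \<open>graft_on ns (Ta # Tb # F)\<close>, where \<open>ns\<close> is the non-empty
  list of decorations from the root down to the first branching vertex.
\<close>

fun graft_on :: "'a list \<Rightarrow> 'a ptree list \<Rightarrow> 'a ptree" where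
  "graft_on [n] F = Node n F"
| "graft_on (n # m # ns) F = Node n [graft_on (m # ns) F]"

fun trunk :: "'a ptree \<Rightarrow> 'a list" where
  "trunk (Node n [T]) = n # trunk T"
| "trunk (Node n Ts) = [n]"

fun branches :: "'a ptree \<Rightarrow> 'a ptree list" where
  "branches (Node n [T]) = branches T"
| "branches (Node n Ts) = Ts"

lemma trunk_not_Nil: "trunk T \<noteq> []"
  by (induction T rule: trunk.induct) auto

lemma graft_on_Cons: "ns \<noteq> [] \<Longrightarrow> graft_on (n # ns) F = Node n [graft_on ns F]"
  by (cases ns) auto

lemma graft_on_trunk_branches: "graft_on (trunk T) (branches T) = T"
  by (induction T rule: trunk.induct) (auto simp: graft_on_Cons trunk_not_Nil)

lemma non_ladder_branches:
  assumes "\<not> ladder T"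
  obtains na Fa nb Fb F where "branches T = Node na Fa # Node nb Fb # F"
proof -
  have "\<exists>A B F. branches T = A # B # F"
    using assms by (induction T rule: branches.induct) auto
  then show thesis using that by (metis ptree.exhaust)
qed

definition tree_sum :: "nat ptree \<Rightarrow> nat ptree" where
  "tree_sum T = (case branches T of Node na Fa # Node nb Fb # F \<Rightarrow>
     graft_on (trunk T) (Node (na + nb) (Fa @ Fb) # F))"

definition tree_b_under_a :: "nat ptree \<Rightarrow> nat ptree" where
  "tree_b_under_a T = (case branches T of Node na Fa # Node nb Fb # F \<Rightarrow>
     graft_on (trunk T) (Node na (Node nb Fb # Fa) # F))"

definition tree_a_under_b :: "nat ptree \<Rightarrow> nat ptree" where
  "tree_a_under_b T = (case branches T of Node na Fa # Node nb Fb # F \<Rightarrow>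
     graft_on (trunk T) (Node nb (Node na Fa # Fb) # F))"

definition correction :: "nat ptree \<Rightarrow> nat ptree fvec" where
  "correction T = (if ladder T then 0 else
    (case branches T of Node na Fa # Node nb Fb # F \<Rightarrow>
       bvec (tree_sum T)
       - (\<Sum>i = 1..na - 1. vscale (of_nat ((na - i + nb - 1) choose (nb - 1)))
            (bvec (graft_on (trunk T) (Node (na + nb - i) (Node i Fa # Fb) # F))))
       - (\<Sum>i = 1..nb - 1. vscale (of_nat ((nb - i + na - 1) choose (na - 1)))
            (bvec (graft_on (trunk T) (Node (na + nb - i) (Node i Fb # Fa) # F))))))"

text \<open>A measure that decreases along the recursion defining the process tree.\<close>

fun process_measure :: "'a ptree \<Rightarrow> nat" where
  "process_measure (Node n Ts) = Suc (prod_list (map process_measure Ts))"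

lemma process_measure_pos: "process_measure T > 0"
  by (cases T) simp

lemma prod_process_measure_pos: "prod_list (map process_measure Ts) > 0"
  by (induction Ts) (auto simp: process_measure_pos)

lemma process_measure_graft_on_mono:
  assumes "ns \<noteq> []"
    and "prod_list (map process_measure F) < prod_list (map process_measure G)"
  shows "process_measure (graft_on ns F) < process_measure (graft_on ns G)"
  using assms(1)
proof (induction ns)
  case (Cons n ns)
  then show ?case using assms(2) by (cases "ns = []") (auto simp: graft_on_Cons)
qed simp

lemma process_measure_decreasing:
  assumes "\<not> ladder T"
  shows "process_measure (tree_sum T) < process_measure T"
    and "process_measure (tree_b_under_a T) < process_measure T"
    and "process_measure (tree_a_under_b T) < process_measure T"
proof -
  obtain na Fa nb Fb F where br: "branches T = Node na Fa # Node nb Fb # F"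
    using assms by (rule non_ladder_branches)
  have *: "process_measure (graft_on (trunk T) (U # F)) < process_measure T"
    if "process_measure U < process_measure (Node na Fa) * process_measure (Node nb Fb)" for U
  proof -
    have "process_measure (graft_on (trunk T) (U # F))
        < process_measure (graft_on (trunk T) (branches T))"
      using that by (intro process_measure_graft_on_mono)
        (auto simp: trunk_not_Nil br prod_process_measure_pos simp del: process_measure.simps
          mult_Suc mult_Suc_right simp flip: mult.assoc)
    then show ?thesis by (simp add: graft_on_trunk_branches)
  qed
  show "process_measure (tree_sum T) < process_measure T"
    unfolding tree_sum_def using prod_process_measure_pos[of Fa]
    by (auto simp: br intro!: *)
  show "process_measure (tree_b_under_a T) < process_measure T"
    unfolding tree_b_under_a_def using prod_process_measure_pos[of Fb]
    by (auto simp: br intro!: *)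
  show "process_measure (tree_a_under_b T) < process_measure T"
    unfolding tree_a_under_b_def using prod_process_measure_pos[of Fa]
    by (auto simp: br intro!: *)
qed

function process_tree :: "nat ptree \<Rightarrow> nat ptree ptree" where
  "process_tree T = (if ladder T then Node T [] else
     Node T [process_tree (tree_sum T), process_tree (tree_b_under_a T),
             process_tree (tree_a_under_b T)])"
  by auto
termination
  by (relation "measure process_measure") (auto simp: process_measure_decreasing)

declare process_tree.simps [simp del]

definition process_sum :: "nat ptree \<Rightarrow> nat ptree fvec" where
  "process_sum T =
     bvec T + (\<Sum>v\<in>vertices (process_tree T). correction (deco (process_tree T) v))"

definition bin_tree :: "nat ptree fvec \<Rightarrow> letter ptree fvec" where
  "bin_tree p = lin_basis bin_naive (lin process_sum p)"

definition bin_tree_inv :: "letter ptree fvec \<Rightarrow> nat ptree fvec" where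
  "bin_tree_inv = inv_into {p. \<forall>T\<in>Poly_Mapping.keys p. 0 \<notin> set_ptree T} bin_tree"


section \<open>Tree zeta values\<close>

typedef conv_tree = "{T :: nat ptree. 0 \<notin> set_ptree T \<and> root_deco T \<noteq> 1}"
  by (rule exI[of _ "Node 2 []"]) simp

definition zeta_tree :: "nat ptree \<Rightarrow> real" where
  "zeta_tree T = (\<Sum>\<^sub>\<infinity>k \<in> {k \<in> vertices T \<rightarrow>\<^sub>E {1 :: nat..}.
       \<forall>u\<in>vertices T. \<forall>v\<in>vertices T. strict_prefix u v \<longrightarrow> k v < k u}.
     \<Prod>v\<in>vertices T. 1 / real (k v) ^ deco T v)"

definition zeta_tree_hom :: "conv_tree mpoly \<Rightarrow> real" where
  "zeta_tree_hom = eval_poly (\<lambda>T. zeta_tree (Rep_conv_tree T))"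

definition tree_poly :: "nat ptree fvec \<Rightarrow> conv_tree mpoly" where
  "tree_poly = linear_poly Rep_conv_tree"

definition R_T :: "conv_tree mpoly set" where
  "R_T = generated_ideal
    ({var S * var T - tree_poly (qsh_tree (Rep_conv_tree S) (Rep_conv_tree T)) | S T. True} \<union>
     {var S * var T - tree_poly (bin_tree_inv (bilin sh_tree
        (bin_tree (bvec (Rep_conv_tree S))) (bin_tree (bvec (Rep_conv_tree T))))) | S T. True} \<union>
     {tree_poly (qsh_tree (Rep_conv_tree U) (Node 1 []) - bin_tree_inv (bilin sh_tree
        (bin_tree (bvec (Rep_conv_tree U))) (bvec (Node LY [])))) | U. True} \<union>
     {var S1 - var S2 | S1 S2.
        forget_order (Rep_conv_tree S1) = forget_order (Rep_conv_tree S2)})"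

end

theory Submission
  imports Defs
begin

text \<open>
  Flattening a tree, i.e. replacing it by the quasi-shuffle of its branches below each vertex, is a
  morphism from \<open>qsh_tree\<close> to \<open>qsh\<close> which ignores the planar order. It intertwines the two
  binarisations: for a single branching vertex this is the formula expanding
  \<open>x^m y u sh x^n y v\<close> with binomial coefficients (\<open>sh_xpow_y\<close>), and the terms \<open>correction\<close> of the
  process tree are exactly what is needed to propagate it. Hence flattening induces an algebra
  morphism mapping \<open>R_T\<close> into \<open>R_W\<close>, and it is a left inverse of the morphism sending a word to
  the ladder tree with the same decorations. As a ladder tree has the zeta value of its word,
  a polynomial in the kernel of \<open>zeta_hom\<close> lifts to the kernel of \<open>zeta_tree_hom\<close>, hence to
  \<open>R_T\<close>, and flattening brings it back into \<open>R_W\<close>.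
\<close>

section \<open>Linear algebra over a basis\<close>

lemma lookup_vscale [simp]: "Poly_Mapping.lookup (vscale c p) a = c * Poly_Mapping.lookup p a"
  by (simp add: vscale_def Poly_Mapping.map.rep_eq when_def)

interpretation fvec: module vscale
  by standard (auto intro!: poly_mapping_eqI simp: lookup_add algebra_simps)

abbreviation flinear :: "('a fvec \<Rightarrow> 'b fvec) \<Rightarrow> bool" where
  "flinear \<equiv> module_hom vscale vscale"

lemma flinearI:
  assumes "\<And>p q. f (p + q) = f p + f q" "\<And>c p. f (vscale c p) = vscale c (f p)"
  shows "flinear f"
  using assms by unfold_locales auto

text \<open>Supports of sums can shrink by cancellation. Summing over a common finite superset makes
  the linearity of \<open>lin\<close> a termwise check.\<close>

lemma lin_superset:
  assumes "finite A" "Poly_Mapping.keys p \<subseteq> A"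
  shows "lin f p = (\<Sum>a\<in>A. vscale (Poly_Mapping.lookup p a) (f a))"
  unfolding lin_def using assms
  by (intro sum.mono_neutral_left) (auto simp: in_keys_iff)

lemma lin_add [simp]: "lin f (p + q) = lin f p + lin f q"
proof -
  let ?A = "Poly_Mapping.keys p \<union> Poly_Mapping.keys q"
  have "finite ?A" by simp
  then show ?thesis
    using Poly_Mapping.keys_add[of p q]
    by (simp add: lin_superset[of ?A] lookup_add fvec.scale_left_distrib sum.distrib)
qed

lemma lin_vscale [simp]: "lin f (vscale c p) = vscale c (lin f p)"
proof -
  have "Poly_Mapping.keys (vscale c p) \<subseteq> Poly_Mapping.keys p"
    by (auto simp: in_keys_iff)
  then show ?thesis
    by (simp add: lin_superset[of "Poly_Mapping.keys p"] fvec.scale_sum_right)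
qed

lemma flinear_lin: "flinear (lin f)"
  by (rule flinearI) simp_all

lemma lin_zero [simp]: "lin f 0 = 0"
  and lin_diff [simp]: "lin f (p - q) = lin f p - lin f q"
  and lin_sum: "lin f (sum g I) = (\<Sum>i\<in>I. lin f (g i))"
  using flinear_lin[of f] by (auto simp: module_hom.diff module_hom.sum module_hom.zero)

lemma lin_bvec [simp]: "lin f (bvec a) = f a"
  by (simp add: lin_def)

lemma fvec_eq_sum: "p = (\<Sum>a\<in>Poly_Mapping.keys p. Poly_Mapping.single a (Poly_Mapping.lookup p a))"
  by (rule poly_mapping_eqI)
    (auto simp: lookup_sum lookup_single when_def in_keys_iff sum.delta)

lemma vscale_bvec: "vscale c (bvec a) = Poly_Mapping.single a c"
  by (rule poly_mapping_eqI) (auto simp: lookup_single when_def)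

lemma lin_bvec_id [simp]: "lin bvec p = p"
  unfolding lin_def vscale_bvec by (rule fvec_eq_sum[symmetric])

text \<open>It also serves as an induction on polynomials, which are vectors over monomials.\<close>

lemma fvec_induct [case_names zero add]:
  fixes p :: "'a fvec"
  assumes "P 0" "\<And>a c p. P p \<Longrightarrow> P (Poly_Mapping.single a c + p)"
  shows "P p"
proof -
  have "finite A \<Longrightarrow> P (\<Sum>a\<in>A. Poly_Mapping.single a (Poly_Mapping.lookup p a))" for A
    by (induction A rule: finite_induct) (auto intro: assms)
  then show ?thesis
    by (subst fvec_eq_sum) simp
qed

lemma flinear_lin_comp: "flinear h \<Longrightarrow> h (lin g p) = lin (\<lambda>a. h (g a)) p"
  unfolding lin_def by (simp add: module_hom.sum module_hom.scale)

lemma flinear_eq_lin: "flinear h \<Longrightarrow> h p = lin (\<lambda>a. h (bvec a)) p"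
  using flinear_lin_comp[of h bvec p] by simp

lemma lin_lin: "lin f (lin g p) = lin (\<lambda>a. lin f (g a)) p"
  by (rule flinear_lin_comp[OF flinear_lin])

lemma lin_cong:
  "(\<And>a. a \<in> Poly_Mapping.keys p \<Longrightarrow> f a = g a) \<Longrightarrow> lin f p = lin g p"
  by (simp add: lin_def)

lemma flinear_comp: "flinear f \<Longrightarrow> flinear g \<Longrightarrow> flinear (\<lambda>x. f (g x))"
  using module_hom_compose[of vscale vscale g vscale f] by (simp add: o_def)

interpretation fvec_pair: module_pair vscale vscale ..

lemma flinear_vscale: "flinear f \<Longrightarrow> flinear (\<lambda>x. vscale c (f x))"
  by (rule fvec_pair.module_hom_scale)

lemmas flinear_add = fvec_pair.module_hom_add
  and flinear_diff = fvec_pair.module_hom_sub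

section \<open>Vectors supported on a given set of basis elements\<close>

definition fspan :: "'a set \<Rightarrow> 'a fvec set" where
  "fspan A = {p. Poly_Mapping.keys p \<subseteq> A}"

lemma fspan_mono: "p \<in> fspan A \<Longrightarrow> A \<subseteq> B \<Longrightarrow> p \<in> fspan B"
  by (auto simp: fspan_def)

lemma fspan_UNIV [simp]: "p \<in> fspan UNIV"
  by (simp add: fspan_def)

lemma fspan_zero [simp]: "0 \<in> fspan A"
  by (simp add: fspan_def)

lemma fspan_bvec [simp]: "bvec a \<in> fspan A \<longleftrightarrow> a \<in> A"
  by (simp add: fspan_def)

lemma fspan_add: "p \<in> fspan A \<Longrightarrow> q \<in> fspan A \<Longrightarrow> p + q \<in> fspan A"
  using Poly_Mapping.keys_add[of p q] by (auto simp: fspan_def)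

lemma fspan_vscale: "p \<in> fspan A \<Longrightarrow> vscale c p \<in> fspan A"
  by (auto simp: fspan_def in_keys_iff)

lemma subspace_fspan: "fvec.subspace (fspan A)"
  by (rule fvec.subspaceI) (auto intro: fspan_add fspan_vscale)

lemmas fspan_diff = fvec.subspace_diff[OF subspace_fspan]
  and fspan_sum = fvec.subspace_sum[OF subspace_fspan]

lemma subspace_lin:
  assumes "fvec.subspace V" "p \<in> fspan A" "\<And>a. a \<in> A \<Longrightarrow> f a \<in> V"
  shows "lin f p \<in> V"
  unfolding lin_def using assms
  by (intro fvec.subspace_sum fvec.subspace_scale) (auto simp: fspan_def)

lemmas fspan_lin = subspace_lin[OF subspace_fspan]

lemma subspace_flinear:
  assumes "flinear f" "fvec.subspace V" "p \<in> fspan A" "\<And>a. a \<in> A \<Longrightarrow> f (bvec a) \<in> V"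
  shows "f p \<in> V"
  using subspace_lin[OF assms(2,3), of "\<lambda>a. f (bvec a)"] assms by (simp flip: flinear_eq_lin)

text \<open>The set \<open>A\<close> makes conditions such as positivity of decorations available
  when an identity is checked on basis elements.\<close>

lemma flinear_eqI:
  assumes "flinear f" "flinear g" "p \<in> fspan A" "\<And>a. a \<in> A \<Longrightarrow> f (bvec a) = g (bvec a)"
  shows "f p = g p"
proof -
  have "lin (\<lambda>a. f (bvec a)) p = lin (\<lambda>a. g (bvec a)) p"
    using assms(3,4) by (intro lin_cong) (auto simp: fspan_def)
  then show ?thesis
    using assms(1,2) by (simp flip: flinear_eq_lin)
qed

section \<open>Bilinear extensions\<close>

lemma flinear_bilin_right: "flinear (bilin f p)"
  unfolding bilin_def lin_def[of _ p]
  by (rule fvec_pair.module_hom_sum)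
    (auto intro!: flinear_vscale flinear_lin fvec.module_axioms)

lemma flinear_bilin_left: "flinear (\<lambda>p. bilin f p q)"
  unfolding bilin_def by (rule flinear_lin)

lemma bilin_bvec [simp]: "bilin f (bvec a) (bvec b) = f a b"
  by (simp add: bilin_def)

lemma bilin_simps [simp]:
  "bilin f p 0 = 0" "bilin f 0 q = 0"
  "bilin f (p + p') q = bilin f p q + bilin f p' q"
  "bilin f p (q + q') = bilin f p q + bilin f p q'"
  "bilin f (vscale c p) q = vscale c (bilin f p q)"
  "bilin f p (vscale c q) = vscale c (bilin f p q)"
  using flinear_bilin_right[of f p]
  by (simp_all only: module_hom.zero module_hom.add module_hom.scale) (simp_all add: bilin_def)

lemmas flinear_intros = flinear_lin flinear_bilin_left flinear_bilin_right
  flinear_comp[OF flinear_lin] flinear_comp[OF flinear_bilin_right]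
  flinear_comp[OF flinear_bilin_left] flinear_vscale flinear_add flinear_diff fvec.module_hom_ident

lemma subspace_bilinear:
  assumes "\<And>q. flinear (\<lambda>p. f p q)" "\<And>p. flinear (f p)" "fvec.subspace V"
    and "p \<in> fspan A" "q \<in> fspan B" "\<And>a b. a \<in> A \<Longrightarrow> b \<in> B \<Longrightarrow> f (bvec a) (bvec b) \<in> V"
  shows "f p q \<in> V"
proof (rule subspace_flinear[OF assms(1,3,4)])
  fix a assume "a \<in> A"
  then show "f (bvec a) q \<in> V"
    using assms(6) by (intro subspace_flinear[OF assms(2,3,5)])
qed

lemma bilinear_eqI:
  assumes "\<And>q. flinear (\<lambda>p. f p q)" "\<And>p. flinear (f p)"
    and "\<And>q. flinear (\<lambda>p. g p q)" "\<And>p. flinear (g p)"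
    and "p \<in> fspan A" "q \<in> fspan B" "\<And>a b. a \<in> A \<Longrightarrow> b \<in> B \<Longrightarrow> f (bvec a) (bvec b) = g (bvec a) (bvec b)"
  shows "f p q = g p q"
proof (rule flinear_eqI[OF assms(1,3,5)])
  fix a assume "a \<in> A"
  then show "f (bvec a) q = g (bvec a) q"
    using assms(7) by (intro flinear_eqI[OF assms(2,4,6)])
qed


section \<open>Quasi-shuffle products of words and trees\<close>

text \<open>The coefficient \<open>e\<close> switches the merging of letters on or off, so that
  \<open>sh\<close> and \<open>qsh\<close> share one theory.\<close>

locale quasi_shuffle =
  fixes e :: rat and mg :: "'a \<Rightarrow> 'a \<Rightarrow> 'a" and m :: "'a list \<Rightarrow> 'a list \<Rightarrow> 'a list fvec"
  assumes m_Nil: "m [] v = bvec v" and m_Nil_right: "m u [] = bvec u"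
    and m_Cons: "m (a # u) (b # v) = lin_basis ((#) a) (m u (b # v)) + lin_basis ((#) b) (m (a # u) v)
      + vscale e (lin_basis ((#) (mg a b)) (m u v))"
    and mg_commute: "mg a b = mg b a" and mg_assoc: "mg (mg a b) c = mg a (mg b c)"
begin

abbreviation cons :: "'a \<Rightarrow> 'a list fvec \<Rightarrow> 'a list fvec" where
  "cons a \<equiv> lin_basis ((#) a)"

abbreviation qs :: "'a list fvec \<Rightarrow> 'a list fvec \<Rightarrow> 'a list fvec" (infixl \<open>\<star>\<close> 70) where
  "p \<star> q \<equiv> bilin m p q"

lemma qs_cons:
  "cons a p \<star> cons b q
    = cons a (p \<star> cons b q) + cons b (cons a p \<star> q) + vscale e (cons (mg a b) (p \<star> q))"
  by (rule bilinear_eqI[where A = UNIV and B = UNIV]) (auto intro!: flinear_intros simp: m_Cons)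

lemma qs_Nil [simp]: "bvec [] \<star> p = p" "p \<star> bvec [] = p"
  by (rule flinear_eqI[where A = UNIV]; auto intro!: flinear_intros simp: m_Nil m_Nil_right)+

lemma m_commute: "m u v = m v u"
proof (induction u arbitrary: v)
  case (Cons a u)
  show ?case
  proof (induction v)
    case (Cons b v)
    then show ?case
      using Cons.IH \<open>\<And>v. m u v = m v u\<close> by (simp add: m_Cons mg_commute[of a] add_ac)
  qed (simp add: m_Nil m_Nil_right)
qed (simp add: m_Nil m_Nil_right)

lemma qs_commute: "p \<star> q = q \<star> p"
  by (rule bilinear_eqI[where A = UNIV and B = UNIV]) (auto intro!: flinear_intros simp: m_commute)

text \<open>Each side splits into seven terms, one for each non-empty subset of the three first
  letters, merged to form the first letter of the result. The terms match by induction on the total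
  length.\<close>

lemma m_assoc: "m u v \<star> bvec w = bvec u \<star> m v w"
proof (induction "length u + length v + length w" arbitrary: u v w rule: less_induct)
  case less
  show ?case
  proof (cases "u = [] \<or> v = [] \<or> w = []")
    case True
    then show ?thesis by (auto simp: m_Nil m_Nil_right)
  next
    case False
    then obtain a u' b v' c w' where uvw: "u = a # u'" "v = b # v'" "w = c # w'"
      by (meson list.exhaust)
    have IH: "m u' v \<star> bvec w = bvec u' \<star> m v w" "m u v' \<star> bvec w = bvec u \<star> m v' w"
       "m u v \<star> bvec w' = bvec u \<star> m v w'" "m u' v' \<star> bvec w = bvec u' \<star> m v' w"
       "m u v' \<star> bvec w' = bvec u \<star> m v' w'" "m u' v \<star> bvec w' = bvec u' \<star> m v w'"
       "m u' v' \<star> bvec w' = bvec u' \<star> m v' w'"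
      by (rule less; simp add: uvw)+
    let ?cw = "cons c (bvec w')" and ?au = "cons a (bvec u')"
    have w: "bvec w = ?cw" and u: "bvec u = ?au" by (simp_all add: uvw)
    have muv: "m u v = cons a (m u' v) + cons b (m u v') + vscale e (cons (mg a b) (m u' v'))"
      and mvw: "m v w = cons b (m v' w) + cons c (m v w') + vscale e (cons (mg b c) (m v' w'))"
      by (simp_all add: uvw m_Cons)
    have "m u v \<star> bvec w = cons a (m u' v \<star> ?cw) + cons b (m u v' \<star> ?cw)
        + vscale e (cons (mg a b) (m u' v' \<star> ?cw)) + cons c (m u v \<star> bvec w')
        + vscale e (cons (mg a c) (m u' v \<star> bvec w'))
        + vscale e (cons (mg b c) (m u v' \<star> bvec w'))
        + vscale e (vscale e (cons (mg (mg a b) c) (m u' v' \<star> bvec w')))"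
      \<comment> \<open>Occurrence 2 of \<open>m u v\<close> is the one under \<open>cons c\<close>
        on the right; expanding it too lets the terms beginning with \<open>c\<close> be compared
        one by one.\<close>
      unfolding w by (subst (1 2) muv) (simp add: qs_cons fvec.scale_right_distrib algebra_simps del: lin_bvec)
    also have "\<dots> = cons a (bvec u' \<star> m v w) + cons b (bvec u \<star> m v' w)
        + vscale e (cons (mg a b) (bvec u' \<star> m v' w)) + cons c (bvec u \<star> m v w')
        + vscale e (cons (mg a c) (bvec u' \<star> m v w'))
        + vscale e (cons (mg b c) (bvec u \<star> m v' w'))
        + vscale e (vscale e (cons (mg a (mg b c)) (bvec u' \<star> m v' w')))"
      unfolding w[symmetric] IH mg_assoc ..
    also have "\<dots> = bvec u \<star> m v w"
      unfolding u by (subst (1 2) mvw) (simp add: qs_cons fvec.scale_right_distrib algebra_simps del: lin_bvec)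
    finally show ?thesis .
  qed
qed

lemma qs_assoc: "p \<star> q \<star> r = p \<star> (q \<star> r)"
proof (rule flinear_eqI[where A = UNIV and p = r])
  fix w
  show "p \<star> q \<star> bvec w = p \<star> (q \<star> bvec w)"
    by (rule bilinear_eqI[where A = UNIV and B = UNIV]) (auto intro!: flinear_intros simp: m_assoc)
qed (auto intro!: flinear_intros)

sublocale qs: comm_monoid "bilin m" "bvec []"
  by unfold_locales (rule qs_assoc qs_commute qs_Nil)+

section \<open>Iterated products and flattening of trees\<close>

definition qprod :: "'a list fvec list \<Rightarrow> 'a list fvec" where
  "qprod ps = foldr (\<star>) ps (bvec [])"

lemma qprod_simps [simp]:
  "qprod [] = bvec []" "qprod (p # ps) = p \<star> qprod ps" "qprod (ps @ rs) = qprod ps \<star> qprod rs"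
  by (induction ps) (auto simp: qprod_def qs_assoc)

text \<open>Multiplications by different factors commute, so the product is a fold over a multiset.
  This is what erases the order of siblings.\<close>

lemma qprod_mset_cong:
  assumes "mset ps = mset rs"
  shows "qprod ps = qprod rs"
proof -
  interpret comp_fun_commute "(\<star>)"
    by standard (auto simp: fun_eq_iff qs.left_commute)
  have "qprod rs = fold_mset (\<star>) (bvec []) (mset rs)" for rs
    by (induction rs) simp_all
  then show ?thesis using assms by simp
qed

text \<open>For \<open>e = 0\<close> this is the sum over all linear extensions of the tree; for \<open>e \<noteq> 0\<close>
  incomparable vertices may also be merged.\<close>

primrec flat :: "'a ptree \<Rightarrow> 'a list fvec" where
  "flat (Node a Ts) = cons a (qprod (map flat Ts))"

lemma flat_forget_order: "forget_order S = forget_order T \<Longrightarrow> flat S = flat T"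
proof (induction S arbitrary: T)
  case (Node a Ss)
  obtain Ts where T: "T = Node a Ts"
    and ms: "mset (map forget_order Ss) = mset (map forget_order Ts)"
    using Node.prems by (cases T) auto
  \<comment> \<open>Equality of multisets gives no explicit matching of the children. Instead,
    \<open>flat\<close> is factored on the children through their non-planar shape: \<open>h\<close>
    evaluates it on a chosen representative in \<open>Ss\<close>.\<close>
  define h where "h n = flat (SOME S. S \<in> set Ss \<and> forget_order S = n)" for n
  have Ss: "flat S = h (forget_order S)" if "S \<in> set Ss" for S
  proof -
    let ?S = "SOME S'. S' \<in> set Ss \<and> forget_order S' = forget_order S"
    have "?S \<in> set Ss \<and> forget_order ?S = forget_order S"
      by (rule someI[of _ S]) (use that in auto)
    then show ?thesis using Node.IH[of ?S S] by (simp add: h_def)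
  qed
  have Ts: "flat U = h (forget_order U)" if "U \<in> set Ts" for U
  proof -
    have "set (map forget_order Ts) = set (map forget_order Ss)"
      using ms[symmetric] by (rule mset_eq_setD)
    moreover have "forget_order U \<in> set (map forget_order Ts)"
      using that by simp
    ultimately have "forget_order U \<in> set (map forget_order Ss)"
      by simp
    then obtain S where S: "S \<in> set Ss" "forget_order S = forget_order U"
      by auto
    then show ?thesis using Node.IH[of S U] Ss[of S] by simp
  qed
  have "map flat Ss = map h (map forget_order Ss)" "map flat Ts = map h (map forget_order Ts)"
    using Ss Ts by simp_all
  then have "mset (map flat Ss) = mset (map flat Ts)"
    using ms by (simp only: mset_map[of h])
  then have "qprod (map flat Ss) = qprod (map flat Ts)"
    by (rule qprod_mset_cong)
  then show ?case unfolding T by simp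
qed

lemma m_fspan:
  assumes "\<And>a b. a \<in> A \<Longrightarrow> b \<in> A \<Longrightarrow> mg a b \<in> A" "u \<in> lists A" "v \<in> lists A"
  shows "m u v \<in> fspan (lists A)"
  using assms(2,3)
proof (induction "length u + length v" arbitrary: u v rule: less_induct)
  case less
  show ?case
  proof (cases "u = [] \<or> v = []")
    case True
    then show ?thesis using less.prems by (auto simp: m_Nil m_Nil_right)
  next
    case False
    then obtain a u' b v' where uv: "u = a # u'" "v = b # v'"
      by (meson list.exhaust)
    then show ?thesis using less.prems assms(1)
      by (auto simp: m_Cons intro!: fspan_add fspan_vscale fspan_lin[OF less.hyps])
  qed
qed

lemma qs_fspan:
  assumes "\<And>a b. a \<in> A \<Longrightarrow> b \<in> A \<Longrightarrow> mg a b \<in> A" "p \<in> fspan (lists A)" "q \<in> fspan (lists A)"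
  shows "p \<star> q \<in> fspan (lists A)"
  by (rule subspace_bilinear[OF _ _ _ assms(2,3)])
    (auto intro!: flinear_intros subspace_fspan m_fspan assms(1))

text \<open>The root is put in front of everything below it, so every word obtained starts with the
  root decoration. This carries convergence from trees to words.\<close>

lemma flat_fspan:
  assumes "\<And>a b. a \<in> A \<Longrightarrow> b \<in> A \<Longrightarrow> mg a b \<in> A" "set_ptree T \<subseteq> A"
  shows "flat T \<in> fspan {w \<in> lists A. w \<noteq> [] \<and> hd w = root_deco T}"
  using assms(2)
proof (induction T)
  case (Node a Ts)
  have "qprod (map flat Us) \<in> fspan (lists A)" if "set Us \<subseteq> set Ts" for Us
    using that
  proof (induction Us)
    case (Cons U Us)
    have "flat U \<in> fspan (lists A)"
      by (rule fspan_mono[OF Node.IH]) (use Cons.prems Node.prems in auto)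
    then show ?case using Cons by (auto intro!: qs_fspan assms(1))
  qed auto
  from this[OF order.refl] show ?case
    using Node.prems by (auto intro!: fspan_lin)
qed

end

section \<open>Tree products and their flattening\<close>

locale quasi_shuffle_tree = quasi_shuffle +
  fixes t :: "'a ptree \<Rightarrow> 'a ptree \<Rightarrow> 'a ptree fvec"
  assumes t_Node: "t (Node a Ss) (Node b Ts) =
     (if Ss = [] then bvec (Node a [Node b Ts])
      else graft_lin a (butlast Ss) (t (last Ss) (Node b Ts)) [])
   + (if Ts = [] then bvec (Node b [Node a Ss])
      else graft_lin b [] (t (Node a Ss) (hd Ts)) (tl Ts))
   + vscale e (if Ss = [] then bvec (Node (mg a b) Ts)
      else if Ts = [] then bvec (Node (mg a b) Ss)
      else graft_lin (mg a b) (butlast Ss) (t (last Ss) (hd Ts)) (tl Ts))"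
begin

lemma lin_flat_graft_lin:
  "lin flat (graft_lin a L p R) = cons a (qprod (map flat L) \<star> lin flat p \<star> qprod (map flat R))"
  unfolding graft_lin_def
  by (rule flinear_eqI[where A = UNIV and p = p]) (auto intro!: flinear_intros simp: qs_assoc)

text \<open>Each summand of \<open>t\<close> performs the smaller product inside one child or
  between two adjacent ones. After flattening, the siblings are multiplied together anyway, so
  associativity turns the three summands into those of \<open>qs_cons\<close>.\<close>

lemma flat_t: "lin flat (t S T) = flat S \<star> flat T"
proof (induction "size S + size T" arbitrary: S T rule: less_induct)
  case less
  obtain a Ss b Ts where ST: "S = Node a Ss" "T = Node b Ts"
    by (meson ptree.exhaust)
  have IH1: "lin flat (t (last Ss) T) = flat (last Ss) \<star> flat T" if "Ss \<noteq> []"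
    by (rule less) (use that size_ptree_child[of "last Ss" Ss] in \<open>simp add: ST\<close>)
  have IH2: "lin flat (t S (hd Ts)) = flat S \<star> flat (hd Ts)" if "Ts \<noteq> []"
    by (rule less) (use that size_ptree_child[of "hd Ts" Ts] in \<open>simp add: ST\<close>)
  have IH3: "lin flat (t (last Ss) (hd Ts)) = flat (last Ss) \<star> flat (hd Ts)" if "Ss \<noteq> []" "Ts \<noteq> []"
    by (rule less) (use that size_ptree_children[of "last Ss" Ss "hd Ts" Ts] in \<open>simp add: ST\<close>)
  have Ss: "qprod (map flat Ss) = qprod (map flat (butlast Ss)) \<star> flat (last Ss)" if "Ss \<noteq> []"
    using that by (subst append_butlast_last_id[symmetric]) (simp_all del: append_butlast_last_id)
  have Ts: "qprod (map flat Ts) = flat (hd Ts) \<star> qprod (map flat (tl Ts))" if "Ts \<noteq> []"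
    using that by (cases Ts) auto
  have "lin flat (t S T) = cons a (qprod (map flat Ss) \<star> flat T)
      + cons b (flat S \<star> qprod (map flat Ts))
      + vscale e (cons (mg a b) (qprod (map flat Ss) \<star> qprod (map flat Ts)))"
    using IH1 IH2 IH3 unfolding ST
    by (auto simp: t_Node lin_flat_graft_lin Ss Ts qs_assoc)
  then show ?case by (simp add: ST qs_cons)
qed

lemma t_fspan:
  assumes "\<And>a b. a \<in> A \<Longrightarrow> b \<in> A \<Longrightarrow> mg a b \<in> A" "set_ptree S \<subseteq> A" "set_ptree T \<subseteq> A"
  shows "t S T \<in> fspan {U. set_ptree U \<subseteq> A}"
  using assms(2,3)
proof (induction "size S + size T" arbitrary: S T rule: less_induct)
  case less
  obtain a Ss b Ts where ST: "S = Node a Ss" "T = Node b Ts"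
    by (meson ptree.exhaust)
  let ?P = "{U. set_ptree U \<subseteq> A}"
  have Ss: "U \<in> set Ss \<Longrightarrow> set_ptree U \<subseteq> A" and Ts: "U \<in> set Ts \<Longrightarrow> set_ptree U \<subseteq> A" for U
    using less.prems by (auto simp: ST)
  have IH: "t (last Ss) T \<in> fspan ?P" if "Ss \<noteq> []"
    by (rule less) (use that less.prems Ss size_ptree_child[of "last Ss" Ss] in \<open>simp_all add: ST\<close>)
  have IH2: "t S (hd Ts) \<in> fspan ?P" if "Ts \<noteq> []"
    by (rule less) (use that less.prems Ts size_ptree_child[of "hd Ts" Ts] in \<open>simp_all add: ST\<close>)
  have IH3: "t (last Ss) (hd Ts) \<in> fspan ?P" if "Ss \<noteq> []" "Ts \<noteq> []"
    by (rule less) (use that Ss Ts less.prems size_ptree_children[of "last Ss" Ss "hd Ts" Ts] in \<open>simp_all add: ST\<close>)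
  have graft: "graft_lin c L p R \<in> fspan ?P"
    if "c \<in> A" "p \<in> fspan ?P" "set L \<subseteq> set Ss" "set R \<subseteq> set Ts" for c L p R
    unfolding graft_lin_def using that Ss Ts by (intro fspan_lin[OF that(2)]) fastforce
  have sub: "set (butlast Ss) \<subseteq> set Ss" "set (tl Ts) \<subseteq> set Ts"
    by (auto dest: in_set_butlastD list.set_sel(2)[rotated] intro: list.set_sel)
  have "a \<in> A" "b \<in> A" using less.prems by (auto simp: ST)
  then show ?case
    using IH IH2 IH3 less.prems assms(1)[of a b] sub unfolding ST t_Node
    by (intro fspan_add fspan_vscale) (auto intro!: graft)
qed

end

interpretation qshuf: quasi_shuffle_tree 1 "(+)" qsh qsh_tree
proof
  show "qsh u [] = bvec u" for u by (cases u) auto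
qed simp_all

text \<open>With coefficient 0 no merged letter survives, so a constant function can stand for
  \<open>mg\<close>: it is trivially commutative and associative.\<close>

interpretation shuf: quasi_shuffle_tree 0 "\<lambda>_ _. undefined" sh sh_tree
proof
  show "sh u [] = bvec u" for u :: "'a list" by (cases u) auto
qed simp_all


section \<open>Products of integrals as sums over shuffles\<close>

abbreviation cx :: "letter list fvec \<Rightarrow> letter list fvec" where
  "cx \<equiv> lin_basis ((#) LX)"

abbreviation cy :: "letter list fvec \<Rightarrow> letter list fvec" where
  "cy \<equiv> lin_basis ((#) LY)"

text \<open>Prefixing \<open>x^n y\<close> binarises the letter \<open>n + 1\<close>. The shift
  keeps truncated subtraction out of the induction on exponents.\<close>

definition xpow_y :: "nat \<Rightarrow> letter list fvec \<Rightarrow> letter list fvec" where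
  "xpow_y n p = (cx ^^ n) (cy p)"

lemma xpow_y_simps [simp]: "xpow_y 0 p = cy p" "xpow_y (Suc n) p = cx (xpow_y n p)"
  by (simp_all add: xpow_y_def)

lemma flinear_xpow_y: "flinear (xpow_y n)"
proof (induction n)
  case 0
  have "xpow_y 0 = cy" by (simp add: fun_eq_iff)
  then show ?case by (simp add: flinear_lin)
next
  case (Suc n)
  have "xpow_y (Suc n) = (\<lambda>p. cx (xpow_y n p))" by (simp add: fun_eq_iff)
  then show ?case using Suc by (simp add: flinear_comp flinear_lin)
qed

text \<open>These are the shuffles of \<open>x^m y p\<close> and \<open>x^n y q\<close> in which the
  displayed \<open>y\<close> of the second factor precedes that of the first. Then \<open>i\<close>
  letters \<open>x\<close> of the first factor stay behind that \<open>y\<close>, and the other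
  \<open>m - i\<close> interleave freely with the \<open>n\<close> of the second; \<open>f i\<close>
  is what remains to be shuffled.\<close>

definition binomial_terms :: "nat \<Rightarrow> nat \<Rightarrow> (nat \<Rightarrow> letter list fvec) \<Rightarrow> letter list fvec" where
  "binomial_terms m n f =
    (\<Sum>i\<le>m. vscale (of_nat ((m - i + n) choose n)) (xpow_y (m + n - i) (f i)))"

lemma binomial_terms_0_Suc: "binomial_terms 0 (Suc n) f = cx (binomial_terms 0 n f)"
  by (simp add: binomial_terms_def)

lemma binomial_terms_Suc_0:
  "binomial_terms (Suc m) 0 f = cx (binomial_terms m 0 f) + cy (f (Suc m))"
  by (simp add: binomial_terms_def lin_sum Suc_diff_le)

text \<open>Pascal's rule, term by term. The index \<open>i = Suc m\<close> occurs only in the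
  second sum on the right, with coefficient one on both sides.\<close>

lemma binomial_terms_Suc_Suc:
  "binomial_terms (Suc m) (Suc n) f
    = cx (binomial_terms m (Suc n) f) + cx (binomial_terms (Suc m) n f)"
proof -
  have "vscale (of_nat ((Suc m - i + Suc n) choose Suc n)) (xpow_y (Suc m + Suc n - i) (f i))
    = cx (vscale (of_nat ((m - i + Suc n) choose Suc n)) (xpow_y (m + Suc n - i) (f i)))
      + cx (vscale (of_nat ((Suc m - i + n) choose n)) (xpow_y (Suc m + n - i) (f i)))"
    if "i \<le> m" for i
    using that by (simp add: Suc_diff_le fvec.scale_left_distrib algebra_simps)
  then show ?thesis
    by (simp add: binomial_terms_def lin_sum sum.distrib binomial_eq_0)
qed

text \<open>The two sums correspond to which of the two displayed letters \<open>y\<close> comes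
  first. The double induction follows the recursion of the shuffle on first letters.\<close>

lemma sh_xpow_y:
  "bilin sh (xpow_y m p) (xpow_y n q)
    = binomial_terms m n (\<lambda>i. bilin sh (xpow_y i p) q)
      + binomial_terms n m (\<lambda>i. bilin sh p (xpow_y i q))"
proof (induction m arbitrary: n)
  case 0
  show ?case
  proof (induction n)
    case 0
    show ?case by (simp add: shuf.qs_cons binomial_terms_def add.commute)
  next
    case (Suc n)
    have "bilin sh (xpow_y 0 p) (xpow_y (Suc n) q)
        = cy (bilin sh p (xpow_y (Suc n) q)) + cx (bilin sh (xpow_y 0 p) (xpow_y n q))"
      by (simp add: shuf.qs_cons)
    then show ?case
      unfolding Suc by (simp add: binomial_terms_0_Suc binomial_terms_Suc_0)
  qed
next
  case (Suc m)
  note m = Suc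
  show ?case
  proof (induction n)
    case 0
    have "bilin sh (xpow_y (Suc m) p) (xpow_y 0 q)
        = cx (bilin sh (xpow_y m p) (xpow_y 0 q)) + cy (bilin sh (xpow_y (Suc m) p) q)"
      by (simp add: shuf.qs_cons)
    then show ?case
      unfolding m by (simp add: binomial_terms_0_Suc binomial_terms_Suc_0)
  next
    case (Suc n)
    have "bilin sh (xpow_y (Suc m) p) (xpow_y (Suc n) q)
        = cx (bilin sh (xpow_y m p) (xpow_y (Suc n) q))
          + cx (bilin sh (xpow_y (Suc m) p) (xpow_y n q))"
      by (simp add: shuf.qs_cons)
    then show ?case
      unfolding m Suc by (simp add: binomial_terms_Suc_Suc add_ac)
  qed
qed

lemma xpow_y_bvec: "xpow_y k (bvec w) = bvec (replicate k LX @ LY # w)"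
  by (induction k) simp_all

lemma bin_cons: "bin (lin_basis ((#) n) p) = xpow_y (n - 1) (bin p)"
proof (rule flinear_eqI[where A = UNIV and p = p])
  show "flinear (\<lambda>p. bin (lin_basis ((#) n) p))"
    unfolding bin_def by (intro flinear_intros)
  show "flinear (\<lambda>p. xpow_y (n - 1) (bin p))"
    unfolding bin_def by (rule flinear_comp[OF flinear_xpow_y flinear_lin])
  show "bin (lin_basis ((#) n) (bvec w)) = xpow_y (n - 1) (bin (bvec w))" for w
    by (simp add: bin_def bin_word_def xpow_y_bvec)
qed simp


section \<open>Flattening commutes with binarisation\<close>

lemma set_ptree_graft_on: "ns \<noteq> [] \<Longrightarrow> set_ptree (graft_on ns F) = set ns \<union> (\<Union>T\<in>set F. set_ptree T)"
  by (induction ns F rule: graft_on.induct) auto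

lemma root_deco_graft_on: "ns \<noteq> [] \<Longrightarrow> root_deco (graft_on ns F) = hd ns"
  by (cases "(ns, F)" rule: graft_on.cases) auto

lemma process_measure_graft_on_cong:
  assumes "ns \<noteq> []" "prod_list (map process_measure F) = prod_list (map process_measure G)"
  shows "process_measure (graft_on ns F) = process_measure (graft_on ns G)"
  using assms(1)
proof (induction ns)
  case (Cons n ns)
  then show ?case using assms(2) by (cases "ns = []") (auto simp: graft_on_Cons)
qed simp

definition bflat :: "nat ptree \<Rightarrow> letter list fvec" where
  "bflat T = shuf.flat (bin_naive T)"

lemma bflat_Node: "bflat (Node n Ts) = xpow_y (n - 1) (shuf.qprod (map bflat Ts))"
proof -
  have "shuf.flat (((\<lambda>T. Node LX [T]) ^^ k) (Node LY Us)) = xpow_y k (shuf.qprod (map shuf.flat Us))"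
    for k Us
    by (induction k) simp_all
  then show ?thesis by (simp add: bflat_def[abs_def] o_def)
qed

text \<open>The trunk acts on the product of its flattened branches by a linear map that depends on
  \<open>ns\<close> alone. Trees with a common trunk can thus be compared at the level of their
  branches.\<close>

lemma bflat_graft_on:
  assumes "ns \<noteq> []"
  obtains h where "flinear h" "\<And>F. bflat (graft_on ns F) = h (shuf.qprod (map bflat F))"
  using assms
proof (induction ns arbitrary: thesis)
  case (Cons n ns)
  show ?case
  proof (cases "ns = []")
    case True
    show ?thesis
      by (rule Cons.prems(1)[of "xpow_y (n - 1)"]) (simp_all add: True flinear_xpow_y bflat_Node)
  next
    case False
    then obtain h where "flinear h" "\<And>F. bflat (graft_on ns F) = h (shuf.qprod (map bflat F))"
      using Cons.IH by blast
    then show ?thesis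
      using False by (intro Cons.prems(1)[of "\<lambda>p. xpow_y (n - 1) (h p)"])
        (simp_all add: flinear_comp flinear_xpow_y bflat_Node graft_on_Cons)
  qed
qed simp

lemma flat_graft_on:
  assumes "ns \<noteq> []"
  obtains h where "flinear h" "\<And>F. qshuf.flat (graft_on ns F) = h (qshuf.qprod (map qshuf.flat F))"
  using assms
proof (induction ns arbitrary: thesis)
  case (Cons n ns)
  show ?case
  proof (cases "ns = []")
    case True
    show ?thesis
      by (rule Cons.prems(1)[of "lin_basis ((#) n)"]) (simp_all add: True flinear_lin)
  next
    case False
    then obtain h where
      "flinear h" "\<And>F. qshuf.flat (graft_on ns F) = h (qshuf.qprod (map qshuf.flat F))"
      using Cons.IH by blast
    then show ?thesis
      using False by (intro Cons.prems(1)[of "\<lambda>p. lin_basis ((#) n) (h p)"])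
        (simp_all add: flinear_comp flinear_lin graft_on_Cons)
  qed
qed simp

text \<open>No vertex has two children, so no product of two non-trivial factors is formed and
  binarisation proceeds letter by letter.\<close>

lemma bin_flat_ladder: "ladder T \<Longrightarrow> bflat T = bin (qshuf.flat T)"
proof (induction T)
  case (Node n Ts)
  show ?case
  proof (cases Ts)
    case Nil
    then show ?thesis by (simp add: bflat_Node bin_cons del: lin_bvec) (simp add: bin_def bin_word_def)
  next
    case (Cons T Us)
    then have "Us = []" using Node.prems by simp
    then show ?thesis using Cons Node.IH[of T] Node.prems by (simp add: bflat_Node bin_cons)
  qed
qed

text \<open>The recursion of the quasi-shuffle, applied to the first two branches, gives one term
  for each possible first letter: \<open>na + nb\<close>, \<open>na\<close> and
  \<open>nb\<close>.\<close>

lemma flat_split: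
  assumes "\<not> ladder T"
  shows "qshuf.flat T
    = qshuf.flat (tree_sum T) + qshuf.flat (tree_b_under_a T) + qshuf.flat (tree_a_under_b T)"
proof -
  obtain na Fa nb Fb F where br: "branches T = Node na Fa # Node nb Fb # F"
    using assms by (rule non_ladder_branches)
  obtain h where h: "flinear h"
    "\<And>F. qshuf.flat (graft_on (trunk T) F) = h (qshuf.qprod (map qshuf.flat F))"
    using flat_graft_on[OF trunk_not_Nil] by blast
  have "qshuf.flat T = qshuf.flat (graft_on (trunk T) (Node na Fa # Node nb Fb # F))"
    by (metis br graft_on_trunk_branches)
  then show ?thesis
    by (simp add: h tree_sum_def tree_b_under_a_def tree_a_under_b_def br qshuf.qs_cons
        qshuf.qs_assoc[symmetric] module_hom.add[OF h(1), symmetric])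
      (simp add: qshuf.qs_commute algebra_simps)
qed

text \<open>By \<open>sh_xpow_y\<close>, the shuffle of the first two branches contains the two
  trees with one branch under the other as its extreme terms. The binomial sums in
  \<open>correction\<close> cancel all the other terms, and its leading summand supplies
  \<open>tree_sum T\<close>, which a shuffle without merging cannot produce.\<close>

lemma bflat_correction:
  assumes "\<not> ladder T" "0 \<notin> set_ptree T"
  shows "bflat T + lin bflat (correction T)
    = bflat (tree_sum T) + bflat (tree_b_under_a T) + bflat (tree_a_under_b T)"
proof -
  obtain na Fa nb Fb F where br: "branches T = Node na Fa # Node nb Fb # F"
    using assms(1) by (rule non_ladder_branches)
  obtain h where h: "flinear h"
    "\<And>F. bflat (graft_on (trunk T) F) = h (shuf.qprod (map bflat F))"
    using bflat_graft_on[OF trunk_not_Nil] by blast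
  have T: "T = graft_on (trunk T) (Node na Fa # Node nb Fb # F)"
    by (metis br graft_on_trunk_branches)
  have "0 \<notin> set_ptree (graft_on (trunk T) (Node na Fa # Node nb Fb # F))"
    using assms(2) T by simp
  then obtain m n where mn: "na = Suc m" "nb = Suc n"
    by (auto simp: set_ptree_graft_on trunk_not_Nil gr0_conv_Suc)
  define fa where "fa = shuf.qprod (map bflat Fa)"
  define fb where "fb = shuf.qprod (map bflat Fb)"
  define f where "f = shuf.qprod (map bflat F)"
  \<comment> \<open>For \<open>i < m\<close>, \<open>u i\<close> matches the term of index
    \<open>i + 1\<close> subtracted in \<open>correction\<close>; \<open>u m\<close> has coefficient
    one and matches \<open>tree_a_under_b T\<close>. The same holds for \<open>v\<close> with the
    branches exchanged.\<close>
  define u where "u i = vscale (of_nat ((m - i + n) choose n))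
    (xpow_y (m + n - i) (bilin sh (xpow_y i fa) fb))" for i
  define v where "v i = vscale (of_nat ((n - i + m) choose m))
    (xpow_y (n + m - i) (bilin sh fa (xpow_y i fb)))" for i
  let ?g = "\<lambda>p. h (bilin sh p f)"
  have g: "flinear ?g" by (intro flinear_comp[OF h(1)] flinear_bilin_left)
  have "bflat T = ?g (bilin sh (xpow_y m fa) (xpow_y n fb))"
    by (subst T) (simp add: h fa_def fb_def f_def bflat_Node mn shuf.qs_assoc)
  also have "bilin sh (xpow_y m fa) (xpow_y n fb) = (\<Sum>i<m. u i) + u m + (\<Sum>i<n. v i) + v n"
    unfolding sh_xpow_y binomial_terms_def u_def v_def by (simp flip: lessThan_Suc_atMost)
  finally have 1: "bflat T = ?g (\<Sum>i<m. u i) + ?g (u m) + ?g (\<Sum>i<n. v i) + ?g (v n)"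
    by (simp only: module_hom.add[OF g])
  have 2: "bflat (tree_a_under_b T) = ?g (u m)"
    by (simp add: tree_a_under_b_def br h u_def fa_def fb_def f_def bflat_Node mn)
  have 3: "bflat (tree_b_under_a T) = ?g (v n)"
    by (simp add: tree_b_under_a_def br h v_def fa_def fb_def f_def bflat_Node mn shuf.qs_commute)
  have "lin bflat (correction T) = bflat (tree_sum T) - (\<Sum>i<m. ?g (u i)) - (\<Sum>i<n. ?g (v i))"
    using assms(1) unfolding correction_def br
    by (simp add: lin_sum mn sum.atLeast1_atMost_eq h bflat_Node u_def v_def module_hom.scale[OF h(1)]
        fa_def fb_def f_def shuf.qs_commute[of "shuf.qprod (map bflat Fa)"] add.commute[of n m])
  then show ?thesis
    by (simp add: 1 2 3 module_hom.sum[OF g])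
qed

section \<open>Sums of corrections over the process tree\<close>

lemma sum_vertices_Node:
  "(\<Sum>v\<in>vertices (Node a Ts). g v) = g [] + (\<Sum>i<length Ts. \<Sum>p\<in>vertices (Ts ! i). g (i # p))"
proof -
  have V: "vertices (Node a Ts) = insert [] (\<Union>i\<in>{..<length Ts}. (#) i ` vertices (Ts ! i))"
  proof (rule set_eqI)
    fix p show "p \<in> vertices (Node a Ts) \<longleftrightarrow> p \<in> insert [] (\<Union>i\<in>{..<length Ts}. (#) i ` vertices (Ts ! i))"
      by (cases p) (auto simp: vertices_def split: if_splits)
  qed
  have "(\<Sum>v\<in>(\<Union>i\<in>{..<length Ts}. (#) i ` vertices (Ts ! i)). g v)
    = (\<Sum>i<length Ts. \<Sum>v\<in>(#) i ` vertices (Ts ! i). g v)"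
    by (rule sum.UNION_disjoint) (auto simp: finite_vertices)
  moreover have "finite (\<Union>i\<in>{..<length Ts}. (#) i ` vertices (Ts ! i))"
    by (auto simp: finite_vertices)
  ultimately show ?thesis
    unfolding V by (subst sum.insert) (auto simp: sum.reindex o_def)
qed

definition corrections :: "nat ptree \<Rightarrow> nat ptree fvec" where
  "corrections T = (\<Sum>v\<in>vertices (process_tree T). correction (deco (process_tree T) v))"

lemma process_sum_eq: "process_sum T = bvec T + corrections T"
  by (simp add: process_sum_def corrections_def)

text \<open>The root of the process tree contributes \<open>correction T\<close>, and its three
  child subtrees contribute the rest.\<close>

lemma corrections_simps:
  "ladder T \<Longrightarrow> corrections T = 0"
  "\<not> ladder T \<Longrightarrow> corrections T = correction T + corrections (tree_sum T)
     + corrections (tree_b_under_a T) + corrections (tree_a_under_b T)"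
proof -
  show "ladder T \<Longrightarrow> corrections T = 0"
    unfolding corrections_def
    by (subst (1 2) process_tree.simps) (simp add: sum_vertices_Node deco_def correction_def)
  show "\<not> ladder T \<Longrightarrow> corrections T = correction T + corrections (tree_sum T)
     + corrections (tree_b_under_a T) + corrections (tree_a_under_b T)"
    unfolding corrections_def
    by (subst (1 2) process_tree.simps)
      (simp add: sum_vertices_Node deco_def lessThan_Suc numeral_3_eq_3 add_ac)
qed

definition pos_trees :: "nat ptree set" where
  "pos_trees = {T. 0 \<notin> set_ptree T}"

lemma pos_trees_split:
  assumes "\<not> ladder T" "T \<in> pos_trees"
  shows "tree_sum T \<in> pos_trees" "tree_b_under_a T \<in> pos_trees" "tree_a_under_b T \<in> pos_trees"
    "correction T \<in> fspan {U \<in> pos_trees. process_measure U < process_measure T}"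
proof -
  obtain na Fa nb Fb F where br: "branches T = Node na Fa # Node nb Fb # F"
    using assms(1) by (rule non_ladder_branches)
  have "0 \<notin> set_ptree (graft_on (trunk T) (Node na Fa # Node nb Fb # F))"
    using assms(2) by (metis br graft_on_trunk_branches pos_trees_def mem_Collect_eq)
  then have pos: "0 \<notin> set (trunk T)" "0 < na" "0 < nb" "\<forall>U\<in>set Fa \<union> set Fb \<union> set F. 0 \<notin> set_ptree U"
    by (auto simp: set_ptree_graft_on trunk_not_Nil)
  then show split: "tree_sum T \<in> pos_trees" "tree_b_under_a T \<in> pos_trees" "tree_a_under_b T \<in> pos_trees"
    by (auto simp: tree_sum_def tree_b_under_a_def tree_a_under_b_def br pos_trees_def
        set_ptree_graft_on trunk_not_Nil)
  \<comment> \<open>These trees differ from \<open>tree_a_under_b T\<close> and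
    \<open>tree_b_under_a T\<close> in at most two decorations, which the measure does not
    see.\<close>
  have "process_measure (graft_on (trunk T) (Node k (Node i Fa # Fb) # F)) < process_measure T"
    "process_measure (graft_on (trunk T) (Node k (Node i Fb # Fa) # F)) < process_measure T" for k i
    using process_measure_decreasing(2,3)[OF assms(1)]
      process_measure_graft_on_cong[OF trunk_not_Nil, of "Node k (Node i Fa # Fb) # F" "Node nb (Node na Fa # Fb) # F" T]
      process_measure_graft_on_cong[OF trunk_not_Nil, of "Node k (Node i Fb # Fa) # F" "Node na (Node nb Fb # Fa) # F" T]
    by (simp_all add: tree_b_under_a_def tree_a_under_b_def br)
  then show "correction T \<in> fspan {U \<in> pos_trees. process_measure U < process_measure T}"
    using assms(1) split process_measure_decreasing(1)[OF assms(1)] pos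
    by (auto simp: correction_def br intro!: fspan_diff fspan_sum fspan_vscale)
      (auto simp: pos_trees_def set_ptree_graft_on trunk_not_Nil)
qed

text \<open>This makes \<open>process_sum\<close> unitriangular: \<open>T\<close> plus trees of
  strictly smaller measure. It is inverted on that ground below.\<close>

lemma corrections_fspan:
  "T \<in> pos_trees \<Longrightarrow> corrections T \<in> fspan {U \<in> pos_trees. process_measure U < process_measure T}"
proof (induction T rule: measure_induct_rule[of process_measure])
  case (less T)
  show ?case
  proof (cases "ladder T")
    case False
    note dec = process_measure_decreasing[OF False] and pos = pos_trees_split[OF False less.prems]
    have "corrections U \<in> fspan {U \<in> pos_trees. process_measure U < process_measure T}"
      if "U \<in> {tree_sum T, tree_b_under_a T, tree_a_under_b T}" for U
      by (rule fspan_mono[OF less.IH]) (use that dec pos in auto)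
    then show ?thesis
      using pos(4) by (simp add: corrections_simps(2)[OF False] fspan_add)
  qed (simp add: corrections_simps)
qed

text \<open>By \<open>bflat_correction\<close>, \<open>T\<close> together with its own correction is
  traded for the three trees derived from it. These absorb the remaining corrections into their own
  \<open>process_sum\<close>, and \<open>flat_split\<close> reassembles the result.\<close>

lemma bflat_process_sum: "T \<in> pos_trees \<Longrightarrow> lin bflat (process_sum T) = bin (qshuf.flat T)"
proof (induction T rule: measure_induct_rule[of process_measure])
  case (less T)
  show ?case
  proof (cases "ladder T")
    case True
    then show ?thesis by (simp add: process_sum_eq corrections_simps bin_flat_ladder)
  next
    case False
    note dec = process_measure_decreasing[OF False] and pos = pos_trees_split[OF False less.prems]
    note IH = less.IH[OF dec(1) pos(1)] less.IH[OF dec(2) pos(2)] less.IH[OF dec(3) pos(3)]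
    have "lin bflat (process_sum T) = bflat T + lin bflat (correction T)
        + lin bflat (corrections (tree_sum T)) + lin bflat (corrections (tree_b_under_a T))
        + lin bflat (corrections (tree_a_under_b T))"
      by (simp add: process_sum_eq corrections_simps(2)[OF False] add_ac)
    also have "\<dots> = lin bflat (process_sum (tree_sum T)) + lin bflat (process_sum (tree_b_under_a T))
        + lin bflat (process_sum (tree_a_under_b T))"
      using less.prems by (subst bflat_correction[OF False])
        (simp_all add: pos_trees_def process_sum_eq add_ac)
    also have "\<dots> = bin (qshuf.flat T)"
      by (simp add: IH flat_split[OF False] bin_def)
    finally show ?thesis .
  qed
qed

lemma flinear_bin_tree: "flinear bin_tree"
  by (rule flinearI) (simp_all add: bin_tree_def)

lemma flat_bin_tree:
  assumes "p \<in> fspan pos_trees"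
  shows "lin shuf.flat (bin_tree p) = bin (lin qshuf.flat p)"
  unfolding bin_tree_def bin_def
  by (rule flinear_eqI[OF _ _ assms])
    (auto intro!: flinear_intros simp: lin_lin bflat_process_sum[symmetric, unfolded bin_def] bflat_def[abs_def])


section \<open>The image of the binarisation map\<close>

text \<open>A unitriangular map is inverted recursively: preimages of the smaller trees in
  \<open>corrections T\<close> are subtracted from \<open>T\<close>.\<close>

lemma process_sum_surj:
  "T \<in> pos_trees \<Longrightarrow> \<exists>p\<in>fspan pos_trees. lin process_sum p = bvec T"
proof (induction T rule: measure_induct_rule[of process_measure])
  case (less T)
  let ?L = "{U \<in> pos_trees. process_measure U < process_measure T}"
  obtain g where g: "\<And>U. U \<in> ?L \<Longrightarrow> g U \<in> fspan pos_trees \<and> lin process_sum (g U) = bvec U"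
    using less.IH by (atomize_elim, intro choice) blast
  have C: "corrections T \<in> fspan ?L" using corrections_fspan less.prems .
  have "lin process_sum (lin g (corrections T)) = corrections T"
    by (rule flinear_eqI[OF _ _ C]) (use g in \<open>auto intro!: flinear_intros\<close>)
  then have "lin process_sum (bvec T - lin g (corrections T)) = bvec T"
    by (simp add: process_sum_eq)
  moreover have "bvec T - lin g (corrections T) \<in> fspan pos_trees"
    using less.prems g by (intro fspan_diff fspan_lin[OF C]) auto
  ultimately show ?case by blast
qed

text \<open>The condition \<open>length Ts \<noteq> 1\<close> covers leaves and branching vertices
  at once. These trees span the image of \<open>bin_tree\<close>.\<close>

fun y_tree :: "letter ptree \<Rightarrow> bool" where
  "y_tree (Node a Ts) \<longleftrightarrow> (length Ts \<noteq> 1 \<longrightarrow> a = LY) \<and> (\<forall>T\<in>set Ts. y_tree T)"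

lemma y_tree_bin_naive: "y_tree (bin_naive T)"
proof (induction T)
  case (Node n Ts)
  have "y_tree (((\<lambda>T. Node LX [T]) ^^ k) (Node LY (map bin_naive Ts)))" for k
    using Node by (induction k) auto
  then show ?case by simp
qed

lemma bin_naive_surj: "y_tree S \<Longrightarrow> \<exists>T\<in>pos_trees. bin_naive T = S"
proof (induction S)
  case (Node a Ss)
  have "\<exists>Ts. set Ts \<subseteq> pos_trees \<and> map bin_naive Ts = Us" if "set Us \<subseteq> set Ss" for Us
    using that
  proof (induction Us)
    case (Cons U Us)
    then obtain Ts where "set Ts \<subseteq> pos_trees" "map bin_naive Ts = Us" by auto
    moreover obtain T where "T \<in> pos_trees" "bin_naive T = U"
      using Node.IH[of U] Node.prems Cons.prems by auto
    ultimately show ?case by (intro exI[of _ "T # Ts"]) auto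
  qed auto
  then obtain Ts where Ts: "set Ts \<subseteq> pos_trees" "map bin_naive Ts = Ss" by blast
  show ?case
  proof (cases a)
    case LY
    then show ?thesis using Ts by (intro bexI[of _ "Node 1 Ts"]) (auto simp: pos_trees_def)
  next
    case LX
    then have "length Ts = 1" using Node.prems Ts(2) by auto
    then obtain n Us where Us: "Ts = [Node n Us]"
      by (metis length_0_conv length_Suc_conv One_nat_def ptree.exhaust)
    \<comment> \<open>The root decoration of the preimage of the only child is raised by one to
      produce the extra \<open>x\<close>. Positivity matters here, since \<open>bin_naive\<close>
      treats the decorations 0 and 1 alike.\<close>
    moreover obtain k where "n = Suc k"
      using Ts(1) Us by (auto simp: pos_trees_def gr0_conv_Suc)
    ultimately show ?thesis
      using Ts LX by (intro bexI[of _ "Node (Suc n) Us"]) (auto simp: pos_trees_def)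
  qed
qed

text \<open>Multiplying into an existing child keeps the number of children, and a leaf that
  receives a tree has exactly one child, in which case its decoration is unconstrained.\<close>

lemma sh_tree_y_tree: "y_tree S \<Longrightarrow> y_tree T \<Longrightarrow> sh_tree S T \<in> fspan {U. y_tree U}"
proof (induction S T rule: sh_tree.induct)
  case (1 a Ss b Ts)
  have last: "y_tree U" if "U \<in> set (butlast Ss) \<or> U = last Ss" "Ss \<noteq> []" for U
    using 1 that by (auto dest: in_set_butlastD)
  have hd: "y_tree U" if "U \<in> set (tl Ts) \<or> U = hd Ts" "Ts \<noteq> []" for U
    using 1 that by (cases Ts) auto
  have len: "Ss \<noteq> [] \<Longrightarrow> Suc (length Ss - 1) = length Ss" "Ts \<noteq> [] \<Longrightarrow> Suc (length Ts - 1) = length Ts"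
    by (cases Ss; simp) (cases Ts; simp)
  show ?case
    using 1 last hd len
    by (auto simp: graft_lin_def intro!: fspan_add fspan_lin[of _ "{U. y_tree U}"])
qed

text \<open>\<open>inv_into\<close> returns a preimage whenever one exists. Preimages of basis trees
  come from \<open>bin_naive_surj\<close> followed by \<open>process_sum_surj\<close>, and are
  extended linearly.\<close>

lemma bin_tree_inv:
  assumes "p \<in> fspan {U. y_tree U}"
  shows "bin_tree_inv p \<in> fspan pos_trees" "bin_tree (bin_tree_inv p) = p"
proof -
  have "\<exists>q\<in>fspan pos_trees. bin_tree q = bvec S" if S: "y_tree S" for S
  proof -
    obtain T where T: "T \<in> pos_trees" "bin_naive T = S" using bin_naive_surj[OF S] by blast
    then obtain q where "q \<in> fspan pos_trees" "lin process_sum q = bvec T"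
      using process_sum_surj by blast
    then show ?thesis using T(2) by (intro bexI[of _ q]) (auto simp: bin_tree_def)
  qed
  then obtain g where g: "\<And>S. y_tree S \<Longrightarrow> g S \<in> fspan pos_trees \<and> bin_tree (g S) = bvec S"
    by (atomize_elim, intro choice) blast
  have "bin_tree (lin g p) = p"
    by (rule flinear_eqI[OF flinear_comp[OF flinear_bin_tree flinear_lin] fvec.module_hom_ident assms])
      (simp add: g)
  moreover have "lin g p \<in> fspan pos_trees"
    using g by (intro fspan_lin[OF assms]) auto
  ultimately have "p \<in> bin_tree ` {p. \<forall>T\<in>Poly_Mapping.keys p. 0 \<notin> set_ptree T}"
    by (intro image_eqI[of _ _ "lin g p"]) (auto simp: fspan_def pos_trees_def)
  from inv_into_into[OF this] f_inv_into_f[OF this]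
  show "bin_tree_inv p \<in> fspan pos_trees" "bin_tree (bin_tree_inv p) = p"
    by (auto simp: bin_tree_inv_def fspan_def pos_trees_def)
qed

section \<open>Evaluation of polynomials\<close>

lemma vscale_mpoly: "vscale c P = Poly_Mapping.single 0 c * (P :: 'i mpoly)"
  by (simp add: vscale_def mult_map_scale_conv_mult)

definition mon :: "('i \<Rightarrow> 'r::comm_ring_1) \<Rightarrow> ('i \<Rightarrow>\<^sub>0 nat) \<Rightarrow> 'r" where
  "mon f m = (\<Prod>i\<in>Poly_Mapping.keys m. f i ^ Poly_Mapping.lookup m i)"

lemma mon_superset:
  assumes "finite A" "Poly_Mapping.keys m \<subseteq> A"
  shows "mon f m = (\<Prod>i\<in>A. f i ^ Poly_Mapping.lookup m i)"
  unfolding mon_def using assms by (intro prod.mono_neutral_left) (auto simp: in_keys_iff)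

lemma mon_add: "mon f (m + n) = mon f m * mon f n"
proof -
  let ?A = "Poly_Mapping.keys m \<union> Poly_Mapping.keys n"
  have "finite ?A" by simp
  then show ?thesis
    using Poly_Mapping.keys_add[of m n]
    by (simp add: mon_superset[of ?A] lookup_add power_add prod.distrib)
qed

lemma mon_simps [simp]: "mon f 0 = 1" "mon f (Poly_Mapping.single i 1) = f i"
  by (simp_all add: mon_def)

lemma mon_var: "mon var m = Poly_Mapping.single m 1"
proof -
  have pow: "var i ^ k = Poly_Mapping.single (Poly_Mapping.single i k) 1" for i :: 'a and k
    by (induction k) (simp_all add: var_def mult_single flip: single_add)
  have "finite A \<Longrightarrow> (\<Prod>i\<in>A. var i ^ Poly_Mapping.lookup m i)
      = Poly_Mapping.single (\<Sum>i\<in>A. Poly_Mapping.single i (Poly_Mapping.lookup m i)) 1" for A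
    by (induction A rule: finite_induct) (simp_all add: pow mult_single)
  moreover have "(\<Sum>i\<in>Poly_Mapping.keys m. Poly_Mapping.single i (Poly_Mapping.lookup m i)) = m"
    by (rule poly_mapping_eqI) (auto simp: lookup_sum lookup_single when_def in_keys_iff)
  ultimately show ?thesis by (simp add: mon_def)
qed

text \<open>The coefficients are sent either to constant polynomials or to real numbers, so
  substitutions and zeta values are instances of one evaluation.\<close>

locale rat_hom =
  fixes c :: "rat \<Rightarrow> 'r::comm_ring_1"
  assumes c_0: "c 0 = 0" and c_1: "c 1 = 1"
    and c_add: "c (x + y) = c x + c y" and c_mult: "c (x * y) = c x * c y"
begin

definition peval :: "('i \<Rightarrow> 'r) \<Rightarrow> 'i mpoly \<Rightarrow> 'r" where
  "peval f P = (\<Sum>m\<in>Poly_Mapping.keys P. c (Poly_Mapping.lookup P m) * mon f m)"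

lemma peval_superset:
  assumes "finite A" "Poly_Mapping.keys P \<subseteq> A"
  shows "peval f P = (\<Sum>m\<in>A. c (Poly_Mapping.lookup P m) * mon f m)"
  unfolding peval_def using assms
  by (intro sum.mono_neutral_left) (auto simp: in_keys_iff c_0)

lemma peval_0 [simp]: "peval f 0 = 0"
  by (simp add: peval_def)

lemma peval_add [simp]: "peval f (P + Q) = peval f P + peval f Q"
proof -
  let ?A = "Poly_Mapping.keys P \<union> Poly_Mapping.keys Q"
  have "finite ?A" by simp
  then show ?thesis
    using Poly_Mapping.keys_add[of P Q]
    by (simp add: peval_superset[of ?A] lookup_add c_add distrib_right sum.distrib)
qed

lemma peval_diff [simp]: "peval f (P - Q) = peval f P - peval f Q"
  by (metis add_diff_cancel diff_add_cancel peval_add)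

lemma peval_single: "peval f (Poly_Mapping.single m a) = c a * mon f m"
  by (simp add: peval_superset[of "{m}"])

lemma peval_1 [simp]: "peval f 1 = 1"
  using peval_single[of f 0 1] by (simp add: c_1)

lemma peval_var [simp]: "peval f (var i) = f i"
  unfolding var_def peval_single mon_simps c_1 by simp

lemma peval_mult [simp]: "peval f (P * Q) = peval f P * peval f Q"
proof (induction P rule: fvec_induct)
  case (add m a P)
  have "peval f (Poly_Mapping.single m a * Q) = peval f (Poly_Mapping.single m a) * peval f Q"
    by (induction Q rule: fvec_induct)
      (simp_all add: mult_single peval_single mon_add c_mult algebra_simps)
  then show ?case by (simp add: add distrib_right)
qed simp

lemma peval_power [simp]: "peval f (P ^ k) = peval f P ^ k"
  by (induction k) simp_all

lemma peval_prod: "peval f (prod g I) = (\<Prod>i\<in>I. peval f (g i))"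
  by (induction I rule: infinite_finite_induct) simp_all

end

interpretation const: rat_hom "Poly_Mapping.single 0 :: rat \<Rightarrow> 'i mpoly"
  by unfold_locales (simp_all add: single_add mult_single)

interpretation real: rat_hom "of_rat :: rat \<Rightarrow> real"
  by unfold_locales (simp_all add: of_rat_add of_rat_mult)

text \<open>It is used both for the zeta value of a polynomial lifted to ladders and for flattening
  such a lift.\<close>

lemma (in rat_hom) peval_peval:
  "peval g (const.peval f P) = peval (\<lambda>i. peval g (f i)) P"
proof (induction P rule: fvec_induct)
  case (add m a P)
  have "peval g (mon f m) = mon (\<lambda>i. peval g (f i)) m"
    by (simp add: mon_def peval_prod)
  then show ?case by (simp add: add const.peval_single peval_single)
qed simp

lemma peval_var_id: "const.peval var P = P"
  by (induction P rule: fvec_induct) (simp_all add: const.peval_single mon_var mult_single)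

lemma eval_poly_eq: "eval_poly f = real.peval f"
  by (simp add: fun_eq_iff eval_poly_def real.peval_def mon_def)

lemma flinear_times: "flinear f \<Longrightarrow> flinear (\<lambda>x. f x * (R :: 'i mpoly))"
  by (rule flinearI) (simp_all add: module_hom.add module_hom.scale distrib_right vscale_mpoly mult.assoc)

lemma flinear_times_left: "flinear f \<Longrightarrow> flinear (\<lambda>x. (R :: 'i mpoly) * f x)"
  using flinear_times[of f R] by (simp add: mult.commute)

lemma flinear_peval: "flinear (const.peval f)"
  by (rule flinearI) (simp_all add: vscale_mpoly const.peval_single)


section \<open>Linear polynomials and ideals\<close>

lemma linear_poly_superset:
  assumes "finite I" "{i. rep i \<in> Poly_Mapping.keys p} \<subseteq> I"
  shows "linear_poly rep p = (\<Sum>i\<in>I. vscale (Poly_Mapping.lookup p (rep i)) (var i))"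
  unfolding linear_poly_def vscale_mpoly[symmetric] using assms
  by (intro sum.mono_neutral_left) (auto simp: in_keys_iff)

lemma flinear_linear_poly:
  assumes "inj rep"
  shows "flinear (linear_poly rep)"
proof (rule flinearI)
  have fin: "finite {i. rep i \<in> Poly_Mapping.keys p}" for p :: "'b fvec"
    using finite_vimageI[OF _ assms, of "Poly_Mapping.keys p"] by (simp add: vimage_def)
  fix p q :: "'b fvec" and c
  let ?I = "{i. rep i \<in> Poly_Mapping.keys p} \<union> {i. rep i \<in> Poly_Mapping.keys q}"
  have "finite ?I" using fin by simp
  then show "linear_poly rep (p + q) = linear_poly rep p + linear_poly rep q"
    using Poly_Mapping.keys_add[of p q]
    by (subst (1 2 3) linear_poly_superset[of ?I])
      (auto simp: lookup_add fvec.scale_left_distrib sum.distrib)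
  show "linear_poly rep (vscale c p) = vscale c (linear_poly rep p)"
    using fin[of p]
    by (subst (1 2) linear_poly_superset[of "{i. rep i \<in> Poly_Mapping.keys p}"])
      (auto simp: fvec.scale_sum_right in_keys_iff)
qed

lemma linear_poly_bvec:
  assumes "inj rep"
  shows "linear_poly rep (bvec (rep i)) = var i"
  using assms by (subst linear_poly_superset[of "{i}"]) (auto simp: inj_eq)

lemma linear_poly_bvec_outside: "a \<notin> range rep \<Longrightarrow> linear_poly rep (bvec a) = 0"
  by (subst linear_poly_superset[of "{}"]) auto

lemma module_mult: "module ((*) :: 'r::comm_ring_1 \<Rightarrow> 'r \<Rightarrow> 'r)"
  by unfold_locales (simp_all add: algebra_simps)

lemma generated_ideal_base: "x \<in> S \<Longrightarrow> x \<in> generated_ideal S"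
  unfolding generated_ideal_def by (rule module.span_base[OF module_mult])

lemma generated_ideal_0: "0 \<in> generated_ideal S"
  and generated_ideal_add: "x \<in> generated_ideal S \<Longrightarrow> y \<in> generated_ideal S \<Longrightarrow> x + y \<in> generated_ideal S"
  and generated_ideal_mult: "x \<in> generated_ideal S \<Longrightarrow> r * x \<in> generated_ideal S"
  unfolding generated_ideal_def
  by (auto intro: module.span_zero[OF module_mult] module.span_add[OF module_mult]
      module.span_scale[OF module_mult])

lemma subspace_generated_ideal: "fvec.subspace (generated_ideal S)" for S :: "'i mpoly set"
  by (rule fvec.subspaceI)
    (auto simp: vscale_mpoly intro: generated_ideal_0 generated_ideal_add generated_ideal_mult)

text \<open>The preimage of an ideal under a ring morphism is an ideal, so it is enough to look at
  generators.\<close>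

lemma generated_ideal_hom:
  assumes "\<And>x. x \<in> S \<Longrightarrow> const.peval f x \<in> generated_ideal T" "x \<in> generated_ideal S"
  shows "const.peval f x \<in> generated_ideal T"
proof -
  have "module.span (*) S \<subseteq> {x. const.peval f x \<in> generated_ideal T}"
    using assms(1)
    by (intro module.span_minimal[OF module_mult] module.subspaceI[OF module_mult])
      (auto intro: generated_ideal_0 generated_ideal_add generated_ideal_mult)
  then show ?thesis using assms(2) by (auto simp: generated_ideal_def)
qed


section \<open>Zeta values of ladder trees\<close>

lemma ladder_vertices:
  "w \<noteq> [] \<Longrightarrow> vertices (graft_on w []) = (\<lambda>i. replicate i 0) ` {..<length w}"
  "w \<noteq> [] \<Longrightarrow> i < length w \<Longrightarrow> deco (graft_on w []) (replicate i 0) = w ! i"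
proof (induction w arbitrary: i)
  case (Cons n w)
  {
    case 1
    show ?case
    proof (cases "w = []")
      case True
      have "vertices (Node n []) = {[]}"
      proof (rule set_eqI)
        fix p show "p \<in> vertices (Node n []) \<longleftrightarrow> p \<in> {[]}"
          by (cases p) (auto simp: vertices_def)
      qed
      then show ?thesis by (simp add: True lessThan_Suc)
    next
      case False
      have "vertices (Node n [T]) = insert [] ((#) 0 ` vertices T)" for n :: 'a and T
      proof (rule set_eqI)
        fix p show "p \<in> vertices (Node n [T]) \<longleftrightarrow> p \<in> insert [] ((#) 0 ` vertices T)"
          by (cases p) (auto simp: vertices_def)
      qed
      then show ?thesis
        by (simp add: graft_on_Cons False Cons.IH lessThan_Suc_eq_insert_0 image_image)
    qed
  next
    case 2
    show ?case
    proof (cases i)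
      case 0
      then show ?thesis by (cases w) (auto simp: deco_def)
    next
      case (Suc j)
      then have "w \<noteq> []" using 2 by auto
      then show ?thesis using Cons.IH(2)[of j] 2 Suc
        by (simp add: graft_on_Cons deco_def)
    qed
  }
qed simp_all

text \<open>The vertex at depth \<open>i\<close> carries letter \<open>i\<close>, and the order on
  vertices is the order of depths. The two sums agree through a bijection of their index sets, so no
  convergence argument enters.\<close>

lemma zeta_tree_ladder:
  assumes "w \<noteq> []"
  shows "zeta_tree (graft_on w []) = zeta w"
proof -
  let ?n = "length w" and ?r = "\<lambda>i. replicate i (0::nat)"
  let ?V = "?r ` {..<?n}"
  let ?K = "{k :: nat list. length k = ?n \<and> sorted_wrt (>) k \<and> 0 \<notin> set k}"
  let ?T = "{k \<in> ?V \<rightarrow>\<^sub>E {1 :: nat..}. \<forall>u\<in>?V. \<forall>v\<in>?V. strict_prefix u v \<longrightarrow> k v < k u}"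
  \<comment> \<open>The length of an address is the depth of the vertex, hence the position in the
    list.\<close>
  let ?g = "\<lambda>k. restrict (\<lambda>v. k ! length v) ?V"
  have prefix: "strict_prefix (?r i) (?r j) \<longleftrightarrow> i < j" for i j
  proof
    show "strict_prefix (?r i) (?r j) \<Longrightarrow> i < j"
      using prefix_length_less by fastforce
    show "i < j \<Longrightarrow> strict_prefix (?r i) (?r j)"
      by (metis append_eq_conv_conj length_replicate less_imp_le_nat order_less_irrefl
          strict_prefix_def take_is_prefix take_replicate min.absorb1)
  qed
  have "bij_betw ?g ?K ?T"
  proof (rule bij_betw_byWitness[where f' = "\<lambda>f. map (\<lambda>i. f (?r i)) [0..<?n]"])
    show "\<forall>k\<in>?K. map (\<lambda>i. ?g k (?r i)) [0..<?n] = k"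
      by (auto intro!: nth_equalityI)
    show "\<forall>f\<in>?T. ?g (map (\<lambda>i. f (?r i)) [0..<?n]) = f"
      by (auto simp: fun_eq_iff PiE_def extensional_def restrict_def)
    show "?g ` ?K \<subseteq> ?T"
    proof (intro image_subsetI CollectI conjI ballI impI)
      fix k :: "nat list" assume k: "k \<in> ?K"
      then show "?g k \<in> ?V \<rightarrow>\<^sub>E {1..}"
        by (auto simp: Suc_le_eq) (metis gr0I nth_mem)
      fix u v assume "u \<in> ?V" "v \<in> ?V" "strict_prefix u v"
      then show "?g k v < ?g k u"
        using k by (auto simp: prefix sorted_wrt_iff_nth_less)
    qed
    show "(\<lambda>f. map (\<lambda>i. f (?r i)) [0..<?n]) ` ?T \<subseteq> ?K"
    proof (intro image_subsetI CollectI conjI)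
      fix f assume f: "f \<in> ?T"
      then show "sorted_wrt (>) (map (\<lambda>i. f (?r i)) [0..<?n])"
        by (auto simp: sorted_wrt_iff_nth_less prefix)
      have "1 \<le> f (?r i)" if "i < ?n" for i
        using f that by (fastforce simp: PiE_iff)
      then show "0 \<notin> set (map (\<lambda>i. f (?r i)) [0..<?n])"
        by fastforce
    qed simp
  qed
  then have "zeta_tree (graft_on w [])
      = (\<Sum>\<^sub>\<infinity>k\<in>?K. \<Prod>v\<in>?V. 1 / real (?g k v) ^ deco (graft_on w []) v)"
    unfolding zeta_tree_def ladder_vertices(1)[OF assms]
    by (rule infsum_reindex_bij_betw[symmetric])
  also have "\<dots> = zeta w"
    unfolding zeta_def
  proof (rule infsum_cong)
    fix k assume "k \<in> ?K"
    have "inj_on ?r {..<?n}" by (rule inj_onI) (metis length_replicate)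
    then show "(\<Prod>v\<in>?V. 1 / real (?g k v) ^ deco (graft_on w []) v)
      = (\<Prod>i<?n. 1 / real (k ! i) ^ (w ! i))"
      by (subst prod.reindex) (auto intro!: prod.cong simp: ladder_vertices(2)[OF assms])
  qed
  finally show ?thesis .
qed

section \<open>The ideals correspond under flattening\<close>

definition pos_words :: "nat list set" where
  "pos_words = {w. 0 \<notin> set w}"

definition conv_words :: "nat list set" where
  "conv_words = {w. w \<noteq> [] \<and> 0 \<notin> set w \<and> hd w \<noteq> 1}"

lemma range_Rep_conv_word: "range Rep_conv_word = conv_words"
  using type_definition.Rep_range[OF type_definition_conv_word] by (simp add: conv_words_def)

lemma inj_Rep_conv_word: "inj Rep_conv_word"
  by (auto simp: inj_def Rep_conv_word_inject)

lemma inj_Rep_conv_tree: "inj Rep_conv_tree"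
  by (auto simp: inj_def Rep_conv_tree_inject)

lemma flinear_word_poly: "flinear word_poly"
  unfolding word_poly_def by (rule flinear_linear_poly[OF inj_Rep_conv_word])

lemma flinear_tree_poly: "flinear tree_poly"
  unfolding tree_poly_def by (rule flinear_linear_poly[OF inj_Rep_conv_tree])

lemma word_poly_Rep [simp]: "word_poly (bvec (Rep_conv_word w)) = var w"
  unfolding word_poly_def by (rule linear_poly_bvec[OF inj_Rep_conv_word])

lemma flat_pos:
  assumes "T \<in> pos_trees"
  shows "qshuf.flat T \<in> fspan {w \<in> pos_words. w \<noteq> [] \<and> hd w = root_deco T}"
  \<comment> \<open>The positive integers appear as \<open>- {0}\<close>; they are closed under the
    merging of letters, which is addition.\<close>
  using assms by (intro fspan_mono[OF qshuf.flat_fspan[of "- {0}" T]])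
    (auto simp: pos_trees_def pos_words_def in_lists_conv_set)

lemma lin_flat_pos: "p \<in> fspan pos_trees \<Longrightarrow> lin qshuf.flat p \<in> fspan pos_words"
  by (erule fspan_lin) (auto intro: fspan_mono[OF flat_pos])

lemma flat_conv: "qshuf.flat (Rep_conv_tree T) \<in> fspan conv_words"
  using Rep_conv_tree[of T]
  by (auto intro!: fspan_mono[OF flat_pos] simp: pos_trees_def pos_words_def conv_words_def)

lemma Rep_conv_tree_pos [simp]: "Rep_conv_tree T \<in> pos_trees"
  using Rep_conv_tree[of T] by (auto simp: pos_trees_def)

definition flat_hom :: "conv_tree mpoly \<Rightarrow> conv_word mpoly" where
  "flat_hom = const.peval (\<lambda>T. word_poly (qshuf.flat (Rep_conv_tree T)))"

text \<open>A tree that is not convergent flattens to words that are not convergent, and both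
  \<open>tree_poly\<close> and \<open>word_poly\<close> discard them.\<close>

lemma flat_hom_tree_poly:
  assumes "p \<in> fspan pos_trees"
  shows "flat_hom (tree_poly p) = word_poly (lin qshuf.flat p)"
proof (rule flinear_eqI[OF _ _ assms])
  show "flinear (\<lambda>p. flat_hom (tree_poly p))"
    unfolding flat_hom_def by (rule flinear_comp[OF flinear_peval flinear_tree_poly])
  show "flinear (\<lambda>p. word_poly (lin qshuf.flat p))"
    by (rule flinear_comp[OF flinear_word_poly flinear_lin])
  fix T assume T: "T \<in> pos_trees"
  show "flat_hom (tree_poly (bvec T)) = word_poly (lin qshuf.flat (bvec T))"
  proof (cases "root_deco T = 1")
    case False
    then obtain S where "T = Rep_conv_tree S"
      using T Rep_conv_tree_cases[of T] by (auto simp: pos_trees_def)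
    then show ?thesis
      by (simp add: tree_poly_def linear_poly_bvec[OF inj_Rep_conv_tree] flat_hom_def)
  next
    case True
    have "T \<notin> range Rep_conv_tree" using True Rep_conv_tree by fastforce
    then have "tree_poly (bvec T) = 0"
      unfolding tree_poly_def by (rule linear_poly_bvec_outside)
    moreover have "word_poly (qshuf.flat T) = 0"
    proof (rule flinear_eqI[OF flinear_word_poly fvec_pair.module_hom_zero flat_pos[OF T]])
      fix w assume "w \<in> {w \<in> pos_words. w \<noteq> [] \<and> hd w = root_deco T}"
      then have "w \<notin> range Rep_conv_word"
        using True by (simp add: range_Rep_conv_word conv_words_def)
      then show "word_poly (bvec w) = 0"
        unfolding word_poly_def by (rule linear_poly_bvec_outside)
    qed
    ultimately show ?thesis by (simp add: flat_hom_def)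
  qed
qed

section \<open>Injectivity of the binarisation of words\<close>

text \<open>The run of \<open>x\<close> before the first \<open>y\<close> has length one less than
  the first letter, which determines that letter because it is positive.\<close>

lemma bin_word_inj: "inj_on bin_word pos_words"
proof (rule inj_onI)
  fix u v show "u \<in> pos_words \<Longrightarrow> v \<in> pos_words \<Longrightarrow> bin_word u = bin_word v \<Longrightarrow> u = v"
  proof (induction u arbitrary: v)
    case Nil
    then show ?case by (cases v) (auto simp: bin_word_def)
  next
    case (Cons a u)
    have tw: "takeWhile (\<lambda>x. x = LX) (bin_word (n # w)) = replicate (n - 1) LX"
      "dropWhile (\<lambda>x. x = LX) (bin_word (n # w)) = LY # bin_word w" for n w
      by (simp_all add: bin_word_def takeWhile_append dropWhile_append)
    obtain b v' where v: "v = b # v'"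
      using Cons.prems(3) by (cases v) (auto simp: bin_word_def)
    have "a - 1 = b - 1" "bin_word u = bin_word v'"
      using arg_cong[OF Cons.prems(3), of "takeWhile (\<lambda>x. x = LX)"]
        arg_cong[OF Cons.prems(3), of "dropWhile (\<lambda>x. x = LX)"] unfolding v tw by simp_all
    then show ?case using Cons.IH[of v'] Cons.prems by (auto simp: v pos_words_def)
  qed
qed

lemma flinear_bin: "flinear bin"
  unfolding bin_def by (rule flinear_lin)

lemma bin_inj: "inj_on bin (fspan pos_words)"
proof (rule inj_on_inverseI)
  fix p assume p: "p \<in> fspan pos_words"
  show "lin_basis (inv_into pos_words bin_word) (bin p) = p"
    unfolding bin_def
    by (rule flinear_eqI[OF flinear_comp[OF flinear_lin flinear_lin] fvec.module_hom_ident p])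
      (simp add: inv_into_f_f[OF bin_word_inj])
qed

lemma bin_inv_bin:
  assumes "p \<in> fspan pos_words"
  shows "bin_inv (bin p) = p"
proof -
  have "{p. \<forall>w\<in>Poly_Mapping.keys p. 0 \<notin> set w} = fspan pos_words"
    by (auto simp: fspan_def pos_words_def)
  then show ?thesis
    using assms unfolding bin_inv_def by (simp add: inv_into_f_f[OF bin_inj])
qed

section \<open>Shuffle products transported through binarisation\<close>

definition word_shuffle :: "nat list fvec \<Rightarrow> nat list fvec \<Rightarrow> nat list fvec" where
  "word_shuffle p q = bin_inv (bilin sh (bin p) (bin q))"

definition tree_shuffle :: "nat ptree fvec \<Rightarrow> nat ptree fvec \<Rightarrow> nat ptree fvec" where
  "tree_shuffle p q = bin_tree_inv (bilin sh_tree (bin_tree p) (bin_tree q))"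

text \<open>Flattening passes through binarisation by \<open>flat_bin_tree\<close> and through the
  tree shuffle by \<open>shuf.flat_t\<close>. Applying \<open>bin_inv\<close> to the resulting
  identity of binary words gives the last claim.\<close>

lemma tree_shuffle:
  assumes "p \<in> fspan pos_trees" "q \<in> fspan pos_trees"
  shows tree_shuffle_pos: "tree_shuffle p q \<in> fspan pos_trees"
    and bin_flat_tree_shuffle: "bin (lin qshuf.flat (tree_shuffle p q))
      = bilin sh (bin (lin qshuf.flat p)) (bin (lin qshuf.flat q))"
    and flat_tree_shuffle: "lin qshuf.flat (tree_shuffle p q)
      = word_shuffle (lin qshuf.flat p) (lin qshuf.flat q)"
proof -
  have y: "bin_tree p \<in> fspan {U. y_tree U}" for p
    unfolding bin_tree_def by (rule fspan_lin[where A = UNIV]) (auto intro: y_tree_bin_naive)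
  have X: "bilin sh_tree (bin_tree p) (bin_tree q) \<in> fspan {U. y_tree U}"
    by (rule subspace_bilinear[OF flinear_bilin_left flinear_bilin_right subspace_fspan y y])
      (simp add: sh_tree_y_tree)
  show pos: "tree_shuffle p q \<in> fspan pos_trees"
    unfolding tree_shuffle_def by (rule bin_tree_inv[OF X])
  have "bin (lin qshuf.flat (tree_shuffle p q)) = lin shuf.flat (bilin sh_tree (bin_tree p) (bin_tree q))"
    unfolding flat_bin_tree[OF pos, symmetric] unfolding tree_shuffle_def bin_tree_inv(2)[OF X] ..
  also have "\<dots> = bilin sh (lin shuf.flat (bin_tree p)) (lin shuf.flat (bin_tree q))"
  proof (rule bilinear_eqI[where A = UNIV and B = UNIV and p = "bin_tree p" and q = "bin_tree q"
        and f = "\<lambda>p q. lin shuf.flat (bilin sh_tree p q)"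
        and g = "\<lambda>p q. bilin sh (lin shuf.flat p) (lin shuf.flat q)"])
    show "flinear (\<lambda>p. lin shuf.flat (bilin sh_tree p q))" for q :: "letter ptree fvec"
      by (rule flinear_comp[OF flinear_lin flinear_bilin_left])
    show "flinear (\<lambda>q. lin shuf.flat (bilin sh_tree p q))" for p :: "letter ptree fvec"
      by (rule flinear_comp[OF flinear_lin flinear_bilin_right])
    show "flinear (\<lambda>p. bilin sh (lin shuf.flat p) (lin shuf.flat q))" for q :: "letter ptree fvec"
      by (rule flinear_comp[OF flinear_bilin_left flinear_lin])
    show "flinear (\<lambda>q. bilin sh (lin shuf.flat p) (lin shuf.flat q))" for p :: "letter ptree fvec"
      by (rule flinear_comp[OF flinear_bilin_right flinear_lin])
  qed (simp_all add: shuf.flat_t)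
  finally show *: "bin (lin qshuf.flat (tree_shuffle p q))
      = bilin sh (bin (lin qshuf.flat p)) (bin (lin qshuf.flat q))"
    using assms by (simp add: flat_bin_tree)
  show "lin qshuf.flat (tree_shuffle p q) = word_shuffle (lin qshuf.flat p) (lin qshuf.flat q)"
    unfolding word_shuffle_def *[symmetric] by (simp add: bin_inv_bin lin_flat_pos[OF pos])
qed

lemma flat_ladder: "w \<noteq> [] \<Longrightarrow> qshuf.flat (graft_on w []) = bvec w"
proof (induction w)
  case (Cons n w)
  then show ?case by (cases "w = []") (simp_all add: graft_on_Cons qshuf.m_Nil_right)
qed simp

text \<open>The shuffle stays in the image of \<open>bin\<close> thanks to trees: \<open>p\<close>
  and \<open>q\<close> lift to ladders, and the flattened tree shuffle of the lifts is a preimage.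
  The empty word is excluded as no tree flattens to it.\<close>

lemma word_shuffle:
  assumes "p \<in> fspan (pos_words - {[]})" "q \<in> fspan (pos_words - {[]})"
  shows word_shuffle_pos: "word_shuffle p q \<in> fspan pos_words"
    and bin_word_shuffle: "bin (word_shuffle p q) = bilin sh (bin p) (bin q)"
proof -
  have *: "\<exists>P\<in>fspan pos_trees. lin qshuf.flat P = p" if p: "p \<in> fspan (pos_words - {[]})" for p
  proof (rule bexI)
    show "lin qshuf.flat (lin_basis (\<lambda>w. graft_on w []) p) = p"
      by (rule flinear_eqI[OF flinear_comp[OF flinear_lin flinear_lin] fvec.module_hom_ident p])
        (simp add: flat_ladder)
    show "lin_basis (\<lambda>w. graft_on w []) p \<in> fspan pos_trees"
      by (rule fspan_lin[OF p]) (auto simp: pos_trees_def pos_words_def set_ptree_graft_on)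
  qed
  obtain P Q where PQ: "P \<in> fspan pos_trees" "lin qshuf.flat P = p"
    "Q \<in> fspan pos_trees" "lin qshuf.flat Q = q"
    using *[OF assms(1)] *[OF assms(2)] by blast
  show "word_shuffle p q \<in> fspan pos_words" "bin (word_shuffle p q) = bilin sh (bin p) (bin q)"
    using lin_flat_pos[OF tree_shuffle_pos[OF PQ(1,3)]] bin_flat_tree_shuffle[OF PQ(1,3)]
    unfolding flat_tree_shuffle[OF PQ(1,3)] PQ(2,4) by simp_all
qed

text \<open>Bilinearity is not built into \<open>bin_inv\<close>, which is a choice of preimages. It
  follows by comparing both sides under \<open>bin\<close>, injective on positive words.\<close>

lemma word_shuffle_bilin:
  assumes "p \<in> fspan (pos_words - {[]})" "q \<in> fspan (pos_words - {[]})"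
  shows "word_shuffle p q = bilin (\<lambda>u v. word_shuffle (bvec u) (bvec v)) p q"
proof (rule inj_onD[OF bin_inj])
  let ?K = "\<lambda>u v. word_shuffle (bvec u) (bvec v)"
  show "bilin ?K p q \<in> fspan pos_words"
    by (rule subspace_bilinear[OF flinear_bilin_left flinear_bilin_right subspace_fspan assms])
      (simp add: word_shuffle_pos)
  have "bin (bilin ?K p q) = bilin sh (bin p) (bin q)"
    by (rule bilinear_eqI[OF flinear_comp[OF flinear_bin flinear_bilin_left]
          flinear_comp[OF flinear_bin flinear_bilin_right]
          flinear_comp[OF flinear_bilin_left flinear_bin]
          flinear_comp[OF flinear_bilin_right flinear_bin] assms])
      (simp add: bin_word_shuffle)
  then show "bin (word_shuffle p q) = bin (bilin ?K p q)"
    using bin_word_shuffle[OF assms] by simp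
qed (rule word_shuffle_pos[OF assms])

lemma conv_words_pos: "p \<in> fspan conv_words \<Longrightarrow> p \<in> fspan (pos_words - {[]})"
  by (erule fspan_mono) (auto simp: conv_words_def pos_words_def)

section \<open>The relations of the word ideal, extended to linear combinations\<close>

lemma subspace_R_W: "fvec.subspace R_W"
  unfolding R_W_def by (rule subspace_generated_ideal)

lemma Rep_conv_word_surj: "w \<in> conv_words \<Longrightarrow> \<exists>v. w = Rep_conv_word v"
  using range_Rep_conv_word by blast

lemma R_W_generators:
  "var v * var w - word_poly (qsh (Rep_conv_word v) (Rep_conv_word w)) \<in> R_W"
  "var v * var w - word_poly (word_shuffle (bvec (Rep_conv_word v)) (bvec (Rep_conv_word w))) \<in> R_W"
  "word_poly (qsh (Rep_conv_word w) [1] - word_shuffle (bvec (Rep_conv_word w)) (bvec [1])) \<in> R_W"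
proof -
  have "bin (bvec [1]) = bvec [LY]"
    by (simp add: bin_def bin_word_def)
  then show
    "var v * var w - word_poly (qsh (Rep_conv_word v) (Rep_conv_word w)) \<in> R_W"
    "var v * var w - word_poly (word_shuffle (bvec (Rep_conv_word v)) (bvec (Rep_conv_word w))) \<in> R_W"
    "word_poly (qsh (Rep_conv_word w) [1] - word_shuffle (bvec (Rep_conv_word w)) (bvec [1])) \<in> R_W"
    unfolding R_W_def word_shuffle_def by (simp_all only:) (rule generated_ideal_base, blast)+
qed

text \<open>A tree flattens to a combination of words, whereas the generators involve single words.
  As an ideal is a linear subspace, the relation extends bilinearly.\<close>

lemma R_W_qsh:
  assumes "p \<in> fspan conv_words" "q \<in> fspan conv_words"
  shows "word_poly p * word_poly q - word_poly (bilin qsh p q) \<in> R_W"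
proof (rule subspace_bilinear[OF _ _ subspace_R_W assms])
  fix u v assume "u \<in> conv_words" "v \<in> conv_words"
  then show "word_poly (bvec u) * word_poly (bvec v) - word_poly (bilin qsh (bvec u) (bvec v)) \<in> R_W"
    by (auto dest!: Rep_conv_word_surj intro: R_W_generators)
next
  show "flinear (\<lambda>p. word_poly p * word_poly q - word_poly (bilin qsh p q))" for q
    by (intro flinear_diff flinear_times flinear_word_poly flinear_comp[OF flinear_word_poly flinear_bilin_left])
  show "flinear (\<lambda>q. word_poly p * word_poly q - word_poly (bilin qsh p q))" for p
    by (intro flinear_diff flinear_times_left flinear_word_poly flinear_comp[OF flinear_word_poly flinear_bilin_right])
qed

lemma R_W_sh:
  assumes "p \<in> fspan conv_words" "q \<in> fspan conv_words"
  shows "word_poly p * word_poly q - word_poly (word_shuffle p q) \<in> R_W"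
  unfolding word_shuffle_bilin[OF assms[THEN conv_words_pos]]
proof (rule subspace_bilinear[OF _ _ subspace_R_W assms])
  let ?K = "\<lambda>u v. word_shuffle (bvec u) (bvec v)"
  fix u v assume "u \<in> conv_words" "v \<in> conv_words"
  then show "word_poly (bvec u) * word_poly (bvec v) - word_poly (bilin ?K (bvec u) (bvec v)) \<in> R_W"
    by (auto dest!: Rep_conv_word_surj intro: R_W_generators)
next
  let ?K = "\<lambda>u v. word_shuffle (bvec u) (bvec v)"
  show "flinear (\<lambda>p. word_poly p * word_poly q - word_poly (bilin ?K p q))" for q
    by (intro flinear_diff flinear_times flinear_word_poly flinear_comp[OF flinear_word_poly flinear_bilin_left])
  show "flinear (\<lambda>q. word_poly p * word_poly q - word_poly (bilin ?K p q))" for p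
    by (intro flinear_diff flinear_times_left flinear_word_poly flinear_comp[OF flinear_word_poly flinear_bilin_right])
qed

text \<open>The word \<open>[1]\<close> is not convergent, so the second factor stays fixed and the
  extension is linear in \<open>p\<close> only.\<close>

lemma R_W_regularised:
  assumes "p \<in> fspan conv_words"
  shows "word_poly (bilin qsh p (bvec [1]) - word_shuffle p (bvec [1])) \<in> R_W"
proof -
  have 1: "bvec [1] \<in> fspan (pos_words - {[]})"
    by (simp add: pos_words_def)
  let ?K = "bilin (\<lambda>u v. word_shuffle (bvec u) (bvec v))"
  have "word_poly (bilin qsh p (bvec [1]) - ?K p (bvec [1])) \<in> R_W"
  proof (rule subspace_flinear[OF _ subspace_R_W assms])
    show "flinear (\<lambda>p. word_poly (bilin qsh p (bvec [1]) - ?K p (bvec [1])))"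
      by (intro flinear_comp[OF flinear_word_poly] flinear_diff flinear_bilin_left)
    fix w assume "w \<in> conv_words"
    then show "word_poly (bilin qsh (bvec w) (bvec [1]) - ?K (bvec w) (bvec [1])) \<in> R_W"
      using R_W_generators(3) by (auto dest!: Rep_conv_word_surj)
  qed
  then show ?thesis
    unfolding word_shuffle_bilin[OF conv_words_pos[OF assms] 1] .
qed

lemma qsh_tree_pos:
  "S \<in> pos_trees \<Longrightarrow> T \<in> pos_trees \<Longrightarrow> qsh_tree S T \<in> fspan pos_trees"
  by (rule fspan_mono[OF qshuf.t_fspan[of "- {0}" S T]]) (auto simp: pos_trees_def)

lemma flat_hom_simps [simp]:
  "flat_hom (P - Q) = flat_hom P - flat_hom Q"
  "flat_hom (P * Q) = flat_hom P * flat_hom Q"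
  "flat_hom (var T) = word_poly (qshuf.flat (Rep_conv_tree T))"
  by (simp_all add: flat_hom_def)

text \<open>The first three families of generators go to the matching relations between words, and
  differences of planar versions of one tree go to zero.\<close>

lemma flat_hom_R_T:
  assumes "P \<in> R_T"
  shows "flat_hom P \<in> R_W"
proof -
  \<comment> \<open>The binary tree in the third family is the binarisation of
    \<open>Node 1 []\<close>, so that family is an instance of \<open>tree_shuffle\<close>.\<close>
  have dot: "Node 1 [] \<in> pos_trees" "bin_tree (bvec (Node 1 [])) = bvec (Node LY [])"
    by (simp_all add: pos_trees_def bin_tree_def process_sum_eq corrections_simps)
  have prod: "flat_hom (var S * var T - tree_poly (qsh_tree (Rep_conv_tree S) (Rep_conv_tree T))) \<in> R_W"
    for S T
    using R_W_qsh[OF flat_conv[of S] flat_conv[of T]]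
    by (simp add: flat_hom_tree_poly qsh_tree_pos qshuf.flat_t)
  have sh: "flat_hom (var S * var T - tree_poly
      (tree_shuffle (bvec (Rep_conv_tree S)) (bvec (Rep_conv_tree T)))) \<in> R_W" for S T
    using R_W_sh[OF flat_conv[of S] flat_conv[of T]]
    by (simp add: flat_hom_tree_poly tree_shuffle_pos flat_tree_shuffle)
  have reg: "flat_hom (tree_poly (qsh_tree (Rep_conv_tree U) (Node 1 [])
      - tree_shuffle (bvec (Rep_conv_tree U)) (bvec (Node 1 [])))) \<in> R_W" for U
    using R_W_regularised[OF flat_conv[of U]] dot(1)
    by (simp add: flat_hom_tree_poly fspan_diff qsh_tree_pos tree_shuffle_pos flat_tree_shuffle
        qshuf.flat_t)
  have perm: "flat_hom (var S1 - var S2) \<in> R_W"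
    if "forget_order (Rep_conv_tree S1) = forget_order (Rep_conv_tree S2)" for S1 S2
    using qshuf.flat_forget_order[OF that] by (simp add: R_W_def generated_ideal_0)
  note gens = prod sh[unfolded tree_shuffle_def] reg[unfolded tree_shuffle_def dot(2)] perm
  \<comment> \<open>Naming the generating set gives the goal the form expected by
    \<open>generated_ideal_hom\<close> and allows folding back to \<open>R_W\<close>.\<close>
  obtain G where G: "R_W = generated_ideal G"
    unfolding R_W_def by blast
  show ?thesis
    using assms unfolding R_T_def G flat_hom_def
    by (rule generated_ideal_hom[rotated], fold G flat_hom_def, elim UnE) (use gens in blast)+
qed

theorem theorem59:
  assumes "{P. zeta_tree_hom P = 0} \<subseteq> R_T"
  shows "{P. zeta_hom P = 0} \<subseteq> R_W"
proof
  fix P assume "P \<in> {P. zeta_hom P = 0}"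
  define lad where "lad w = Abs_conv_tree (graft_on (Rep_conv_word w) [])" for w
  have Rep: "Rep_conv_word w \<noteq> []" "0 \<notin> set (Rep_conv_word w)" "hd (Rep_conv_word w) \<noteq> 1" for w
    using Rep_conv_word[of w] by auto
  \<comment> \<open>The first letter of the word decorates the root of its ladder, so the ladder is
    convergent.\<close>
  have lad: "Rep_conv_tree (lad w) = graft_on (Rep_conv_word w) []" for w
    unfolding lad_def using Rep
    by (intro Abs_conv_tree_inverse) (simp add: set_ptree_graft_on root_deco_graft_on)
  define Q where "Q = const.peval (\<lambda>w. var (lad w)) P"
  have "zeta_tree_hom Q = zeta_hom P"
    by (simp add: zeta_tree_hom_def zeta_hom_def eval_poly_eq Q_def real.peval_peval lad
        zeta_tree_ladder Rep)
  then have "Q \<in> R_T"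
    using assms \<open>P \<in> {P. zeta_hom P = 0}\<close> by auto
  then have "flat_hom Q \<in> R_W"
    by (rule flat_hom_R_T)
  also have "flat_hom Q = P"
    by (simp add: flat_hom_def Q_def const.peval_peval lad flat_ladder Rep peval_var_id)
  finally show "P \<in> R_W" .
qed

end
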